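(* Let $\{(N_n,B_n,L_n)\}_{n\ge 1}$ be a sequence of Hadamard triples with $B_n\subset\{0,1,\dots,N_n-1\}$ for all $n\ge 1$, such that $\{\nu_{>n}\}$ converges weakly to $\rho=\frac12(\delta_0+\delta_1)$ and $\lim_{n\to\infty}\#B_n=\infty$. Suppose that $(N_n,B_n)$ is symmetric and that there exist $\delta\in(0,1/3)$ and a subsequence $\{n_j\}$ such that the sum of sine problem holds for $\mathcal{B}=\{B_{n_j,\delta,0}: j\ge 1\}$. Then the associated Cantor-Moran measure $\mu(N_n,B_n)$ is a spectral measure.
   Context: A Hadamard triple $(N,B,L)$ consists of an integer $N\ge 2$ and finite sets $B,L\subset\mathbb{Z}$ with $\#B=\#L=M\le N$ such that the matrix $H=\frac{1}{\sqrt M}\left[e^{-2\pi i bl/N}\right]_{b\in B,\,l\in L}$ is unitary. For a finite nonempty set $A\subset\mathbb{R}$, $\delta_A=\frac{1}{\#A}\sum_{a\in A}\delta_a$, where $\delta_a$ is the Dirac measure at $a$. The Cantor-Moran measure is $\mu(N_n,B_n)=\delta_{\frac{1}{N_1}B_1}\ast\delta_{\frac{1}{N_1N_2}B_2}\ast\cdots$ (weak limit of the finite convolutions), a Borel probability measure supported in $[0,1]$. Write $\mu=\mu_n\ast\mu_{>n}$, where $\mu_n$ is the convolution of the first $n$ discrete measures and $\mu_{>n}$ the convolution of the remaining ones, and let $\nu_{>n}(E)=\mu_{>n}\big((N_1\cdots N_n)^{-1}E\big)$; thus $\nu_{>n}=\delta_{\frac{1}{N_{n+1}}B_{n+1}}\ast\delta_{\frac{1}{N_{n+1}N_{n+2}}B_{n+2}}\ast\cdots$.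 A Borel probability measure $\mu$ on $\mathbb{R}$ is a spectral measure if there is a countable set $\Lambda\subset\mathbb{R}$ such that $\{e^{2\pi i\lambda x}:\lambda\in\Lambda\}$ is an orthonormal basis of $L^2(\mu)$. For $0<\delta<1/3$ let $B_{n,\delta}=\{b\in B_n: b/N_n\notin(\delta,1-\delta)\}$, $B_{n,\delta,0}=B_{n,\delta}\cap[0,N_n\delta]$, and $B_{n,\delta,1}=N_n-\big(B_{n,\delta}\cap[N_n(1-\delta),N_n)\big)$. The sequence $(N_n,B_n)$ is symmetric if for all sufficiently small $\delta>0$ there is $n_0$ such that for all $n\ge n_0$ one has $B_n=B_{n,\delta}$ and $B_{n,\delta,1}=B_{n,\delta,0}\setminus\{0\}$. For a collection $\mathcal{B}$ of finite sets of nonnegative integers, the sum of sine problem holds for $\mathcal{B}$ if there exist $\epsilon_0>0$ and $\delta_0\in(0,1/2)$ such that for every $B\in\mathcal{B}$, $\max_{x\in[0,\frac12-\delta_0]}\left|\sum_{b\in B}\sin(2\pi b x)\right|\ge\epsilon_0\,(\#B)$. *)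

theory Defs
  imports "HOL-Probability.Probability"
begin

section \<open>Hadamard triples\<close>

text \<open>Matrices whose rows and columns are indexed by finite sets are functions of two
  arguments; unitarity is \<open>H H\<^sup>* = I\<close> and \<open>H\<^sup>* H = I\<close>.\<close>

definition unitary_on :: "'a set \<Rightarrow> 'b set \<Rightarrow> ('a \<Rightarrow> 'b \<Rightarrow> complex) \<Rightarrow> bool" where
  "unitary_on I J H \<longleftrightarrow>
     (\<forall>i\<in>I. \<forall>i'\<in>I. (\<Sum>j\<in>J. H i j * cnj (H i' j)) = of_bool (i = i')) \<and>
     (\<forall>j\<in>J. \<forall>j'\<in>J. (\<Sum>i\<in>I. cnj (H i j) * H i j') = of_bool (j = j'))"

text \<open>\<open>B\<close> is nonempty because of the factor \<open>1 / \<surd>M\<close> and because the uniform measures below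
  are normalised by \<open>1 / #B\<close>.\<close>

definition hadamard_triple :: "int \<Rightarrow> int set \<Rightarrow> int set \<Rightarrow> bool" where
  "hadamard_triple N B L \<longleftrightarrow>
     N \<ge> 2 \<and> finite B \<and> finite L \<and> B \<noteq> {} \<and> card B = card L \<and> int (card B) \<le> N \<and>
     unitary_on B L (\<lambda>b l. 1 / complex_of_real (sqrt (real (card B))) *
        exp (- 2 * complex_of_real pi * \<i> * of_int b * of_int l / of_int N))"

section \<open>Infinite convolutions and Cantor-Moran measures\<close>

text \<open>Intended for finite nonempty \<open>A\<close>.\<close>

definition uniform_delta :: "real set \<Rightarrow> real measure" where
  "uniform_delta A = distr (measure_pmf (pmf_of_set A)) borel (\<lambda>a. a)"

lemma measure_uniform_delta:
  assumes "finite A" "A \<noteq> {}" "E \<in> sets borel"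
  shows "measure (uniform_delta A) E = (\<Sum>a\<in>A. measure (return borel a) E) / real (card A)"
proof -
  have "(\<Sum>a\<in>A. measure (return borel a) E) = (\<Sum>a\<in>A. indicator E a)"
    by (intro sum.cong) (simp_all add: measure_return assms(3))
  then show ?thesis
    using assms by (simp add: uniform_delta_def measure_distr measure_pmf_of_set
        sum.If_cases indicator_def of_bool_def Int_commute)
qed

lemma real_distribution_uniform_delta: "real_distribution (uniform_delta A)"
  unfolding uniform_delta_def
  by (rule prob_space.real_distribution_distr) (auto simp: measure_pmf.prob_space_axioms)

fun finite_convolution :: "(nat \<Rightarrow> real measure) \<Rightarrow> nat \<Rightarrow> real measure" where
  "finite_convolution m 0 = return borel 0"
| "finite_convolution m (Suc n) = convolution (finite_convolution m n) (m n)"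

definition infinite_convolution :: "(nat \<Rightarrow> real measure) \<Rightarrow> real measure" where
  "infinite_convolution m =
     (THE \<mu>. real_distribution \<mu> \<and> weak_conv_m (finite_convolution m) \<mu>)"

lemma real_distribution_finite_convolution:
  assumes "\<And>k. real_distribution (m k)"
  shows "real_distribution (finite_convolution m n)"
proof (induction n)
  case 0
  show ?case
    by (auto simp: real_distribution_def real_distribution_axioms_def intro!: prob_space_return)
next
  case (Suc n)
  interpret A: real_distribution "finite_convolution m n" by fact
  interpret B: real_distribution "m n" by (rule assms)
  interpret P: pair_prob_space "finite_convolution m n" "m n" ..
  show ?case
    unfolding finite_convolution.simps convolution_def
    by (rule prob_space.real_distribution_distr) (simp_all add: P.prob_space_axioms)
qed

lemma infinite_convolution_eqI:
  assumes m: "\<And>k. real_distribution (m k)"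
    and \<mu>: "real_distribution \<mu>" "weak_conv_m (finite_convolution m) \<mu>"
  shows "infinite_convolution m = \<mu>"
  unfolding infinite_convolution_def
proof (rule the_equality)
  fix \<nu> assume \<nu>: "real_distribution \<nu> \<and> weak_conv_m (finite_convolution m) \<nu>"
  have lim: "(\<lambda>n. char (finite_convolution m n) t) \<longlonglongrightarrow> char \<kappa> t"
    if "real_distribution \<kappa>" "weak_conv_m (finite_convolution m) \<kappa>" for \<kappa> t
    using that by (intro levy_continuity1 real_distribution_finite_convolution m) auto
  have "char \<nu> t = char \<mu> t" for t
    using lim[of \<nu> t] lim[of \<mu> t] \<nu> \<mu> by (blast intro: LIMSEQ_unique)
  then show "\<nu> = \<mu>" using \<nu> \<mu> by (intro Levy_uniqueness) (auto simp: fun_eq_iff)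
qed (use \<mu> in auto)

text \<open>Sequences \<open>N\<close>, \<open>B\<close> are indexed from 1; their values at 0 are never used.\<close>

definition moran_factor :: "(nat \<Rightarrow> int) \<Rightarrow> (nat \<Rightarrow> int set) \<Rightarrow> nat \<Rightarrow> real measure" where
  "moran_factor N B n =
     uniform_delta ((\<lambda>b. 1 / real_of_int (\<Prod>i=1..n. N i) * real_of_int b) ` B n)"

definition cantor_moran :: "(nat \<Rightarrow> int) \<Rightarrow> (nat \<Rightarrow> int set) \<Rightarrow> real measure" where
  "cantor_moran N B = infinite_convolution (\<lambda>k. moran_factor N B (Suc k))"

text \<open>\<open>moran_tail N B n\<close> is \<open>\<mu>\<^bsub>>n\<^esub>\<close>, and \<open>moran_tail_rescaled N B n\<close> is \<open>\<nu>\<^bsub>>n\<^esub>\<close>: the preimage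
  of \<open>E\<close> under multiplication by \<open>N\<^sub>1 \<dots> N\<^sub>n\<close> is \<open>(N\<^sub>1 \<dots> N\<^sub>n)\<^sup>-\<^sup>1 E\<close>.\<close>

definition moran_tail :: "(nat \<Rightarrow> int) \<Rightarrow> (nat \<Rightarrow> int set) \<Rightarrow> nat \<Rightarrow> real measure" where
  "moran_tail N B n = infinite_convolution (\<lambda>k. moran_factor N B (n + Suc k))"

definition moran_tail_rescaled :: "(nat \<Rightarrow> int) \<Rightarrow> (nat \<Rightarrow> int set) \<Rightarrow> nat \<Rightarrow> real measure" where
  "moran_tail_rescaled N B n =
     distr (moran_tail N B n) borel (\<lambda>x. real_of_int (\<Prod>i=1..n. N i) * x)"

section \<open>Spectral measures\<close>

text \<open>Elements of \<open>L\<^sup>2(M)\<close> are represented by square-integrable complex functions. An orthonormal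
  basis is an orthonormal family whose finite linear combinations are dense in \<open>L\<^sup>2(M)\<close>.\<close>

definition square_integrable :: "'a measure \<Rightarrow> ('a \<Rightarrow> complex) \<Rightarrow> bool" where
  "square_integrable M f \<longleftrightarrow> f \<in> borel_measurable M \<and> integrable M (\<lambda>x. (cmod (f x))\<^sup>2)"

definition L2_inner :: "'a measure \<Rightarrow> ('a \<Rightarrow> complex) \<Rightarrow> ('a \<Rightarrow> complex) \<Rightarrow> complex" where
  "L2_inner M f g = (\<integral>x. f x * cnj (g x) \<partial>M)"

definition L2_norm :: "'a measure \<Rightarrow> ('a \<Rightarrow> complex) \<Rightarrow> real" where
  "L2_norm M f = sqrt (\<integral>x. (cmod (f x))\<^sup>2 \<partial>M)"

definition orthonormal_basis_L2 :: "'a measure \<Rightarrow> 'i set \<Rightarrow> ('i \<Rightarrow> 'a \<Rightarrow> complex) \<Rightarrow> bool" where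
  "orthonormal_basis_L2 M I e \<longleftrightarrow>
     (\<forall>i\<in>I. square_integrable M (e i)) \<and>
     (\<forall>i\<in>I. \<forall>j\<in>I. L2_inner M (e i) (e j) = of_bool (i = j)) \<and>
     (\<forall>f. square_integrable M f \<longrightarrow>
        (\<forall>\<epsilon>>0. \<exists>F c. finite F \<and> F \<subseteq> I \<and> L2_norm M (\<lambda>x. f x - (\<Sum>i\<in>F. c i * e i x)) < \<epsilon>))"

definition spectral_measure :: "real measure \<Rightarrow> bool" where
  "spectral_measure \<mu> \<longleftrightarrow> real_distribution \<mu> \<and>
     (\<exists>\<Lambda>::real set. countable \<Lambda> \<and>
        orthonormal_basis_L2 \<mu> \<Lambda>
          (\<lambda>l x. exp (2 * complex_of_real pi * \<i> * complex_of_real l * complex_of_real x)))"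

section \<open>Symmetric sequences and the sum of sine problem\<close>

text \<open>\<open>near_ends\<close>, \<open>near_zero\<close> and \<open>near_one\<close> are \<open>B\<^bsub>n,\<delta>\<^esub>\<close>, \<open>B\<^bsub>n,\<delta>,0\<^esub>\<close> and \<open>B\<^bsub>n,\<delta>,1\<^esub>\<close> for
  \<open>N = N\<^sub>n\<close>, \<open>B = B\<^sub>n\<close>.\<close>

definition near_ends :: "int \<Rightarrow> int set \<Rightarrow> real \<Rightarrow> int set" where
  "near_ends N B \<delta> = {b \<in> B. real_of_int b / real_of_int N \<notin> {\<delta> <..< 1 - \<delta>}}"

definition near_zero :: "int \<Rightarrow> int set \<Rightarrow> real \<Rightarrow> int set" where
  "near_zero N B \<delta> = {b \<in> near_ends N B \<delta>. real_of_int b \<in> {0 .. real_of_int N * \<delta>}}"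

definition near_one :: "int \<Rightarrow> int set \<Rightarrow> real \<Rightarrow> int set" where
  "near_one N B \<delta> = (\<lambda>b. N - b) `
     {b \<in> near_ends N B \<delta>. real_of_int b \<in> {real_of_int N * (1 - \<delta>) ..< real_of_int N}}"

definition symmetric_sequence :: "(nat \<Rightarrow> int) \<Rightarrow> (nat \<Rightarrow> int set) \<Rightarrow> bool" where
  "symmetric_sequence N B \<longleftrightarrow>
     (\<forall>\<^sub>F \<delta> in at_right 0. \<exists>n0. \<forall>n\<ge>n0.
        B n = near_ends (N n) (B n) \<delta> \<and>
        near_one (N n) (B n) \<delta> = near_zero (N n) (B n) \<delta> - {0})"

text \<open>Intended for collections of finite sets of nonnegative integers; the supremum is then the
  maximum of a continuous function on a compact interval.\<close>

definition sum_of_sine :: "int set set \<Rightarrow> bool" where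
  "sum_of_sine \<B> \<longleftrightarrow>
     (\<exists>\<epsilon>0 \<delta>0. \<epsilon>0 > 0 \<and> \<delta>0 \<in> {0<..<1/2} \<and>
        (\<forall>B\<in>\<B>. (SUP x\<in>{0 .. 1/2 - \<delta>0}. \<bar>\<Sum>b\<in>B. sin (2 * pi * real_of_int b * x)\<bar>)
                   \<ge> \<epsilon>0 * real (card B)))"

end

theory Submission
  imports Defs
begin

text \<open>
  Write \<open>F\<close> for the Fourier transform and \<open>P\<^sub>n = N\<^sub>1 \<cdots> N\<^sub>n\<close>. The measure \<open>\<mu>\<^sub>n\<close> has spectra \<open>\<Lambda>\<^sub>n \<subseteq> \<int>\<close>, built from the \<open>L\<^sub>i\<close>, and
  \<open>|F\<mu>(\<xi>)| = |F\<mu>\<^sub>n(\<xi>)| |F\<nu>\<^bsub>>n\<^esub>(\<xi> / P\<^sub>n)|\<close>. If for infinitely many \<open>n\<close> every real \<open>x\<close> has an integer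
  translate at which \<open>|F\<nu>\<^bsub>>n\<^esub>| \<ge> \<epsilon>\<close>, with \<open>\<epsilon>\<close> independent of \<open>n\<close> and \<open>x\<close>, then the \<open>\<Lambda>\<^sub>n\<close> can be chosen
  increasing and such that the second factor is at least \<open>\<epsilon>\<close> on \<open>\<Lambda>\<^sub>n\<close>. The Parseval identities
  \<open>\<Sum>\<^sub>\<lambda> |F\<mu>\<^sub>n(\<xi> + \<lambda>)|\<^sup>2 = 1\<close> then survive the limit by domination, so every exponential, and hence all of
  \<open>L\<^sup>2(\<mu>)\<close>, lies in the closed span of those with frequency in \<open>\<Union> \<Lambda>\<^sub>n\<close>.

  Away from \<open>1/2 + \<int>\<close> the lower bound comes from \<open>|F\<nu>\<^bsub>>n\<^esub>(x)| \<rightarrow> |cos (\<pi> x)|\<close>, uniformly on compact sets because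
  all \<open>F\<nu>\<^bsub>>n\<^esub>\<close> are \<open>2\<pi>\<close>-Lipschitz. At \<open>1/2 + k\<close> the factor of \<open>B\<^sub>n\<close> in \<open>F\<nu>\<^bsub>>n-1\<^esub>\<close> is, by symmetry, at least
  \<open>2 |\<Sum> sin (2 \<pi> b t)| / #B\<^sub>n\<close> in modulus with \<open>t = (1/2 + k) / N\<^sub>n\<close> and \<open>b\<close> ranging over the digits near zero;
  \<open>k\<close> is chosen so that \<open>t\<close> is close to a point of \<open>[0, 1/2 - \<delta>\<^sub>0]\<close> supplied by the sum of sine problem, where
  \<open>|cos (\<pi> t)|\<close> is also bounded below.
\<close>

section \<open>Closed linear spans in \<open>L\<^sup>2\<close>\<close>

text \<open>Takes the place of the triangle inequality in L2, so that closeness can be measured by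
  squared distances throughout. The factor 2 on both terms is why the arguments below start from
  approximations within \<open>\<epsilon> / 4\<close>.\<close>

lemma norm_add_square_le:
  fixes a b :: "'a::real_normed_vector"
  shows "(norm (a + b))\<^sup>2 \<le> 2 * (norm a)\<^sup>2 + 2 * (norm b)\<^sup>2"
proof -
  have "(norm (a + b))\<^sup>2 \<le> (norm a + norm b)\<^sup>2"
    by (intro power_mono norm_triangle_ineq norm_ge_zero)
  also have "\<dots> \<le> 2 * (norm a)\<^sup>2 + 2 * (norm b)\<^sup>2"
    using sum_squares_bound[of "norm a" "norm b"] by (simp add: power2_sum)
  finally show ?thesis .
qed

lemma square_integrable_add:
  assumes "square_integrable M f" "square_integrable M g"
  shows "square_integrable M (\<lambda>x. f x + g x)"
proof -
  have [measurable]: "f \<in> borel_measurable M" "g \<in> borel_measurable M"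
    using assms by (auto simp: square_integrable_def)
  have "integrable M (\<lambda>x. 2 * (cmod (f x))\<^sup>2 + 2 * (cmod (g x))\<^sup>2)"
    using assms by (auto simp: square_integrable_def)
  then have "integrable M (\<lambda>x. (cmod (f x + g x))\<^sup>2)"
    by (rule Bochner_Integration.integrable_bound) (auto intro: norm_add_square_le)
  then show ?thesis by (auto simp: square_integrable_def)
qed

lemma integral_norm_add_square_le:
  assumes "square_integrable M f" "square_integrable M g"
  shows "(\<integral>x. (cmod (f x + g x))\<^sup>2 \<partial>M) \<le> 2 * (\<integral>x. (cmod (f x))\<^sup>2 \<partial>M) + 2 * (\<integral>x. (cmod (g x))\<^sup>2 \<partial>M)"
proof -
  have "(\<integral>x. (cmod (f x + g x))\<^sup>2 \<partial>M) \<le> (\<integral>x. 2 * (cmod (f x))\<^sup>2 + 2 * (cmod (g x))\<^sup>2 \<partial>M)"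
    using assms square_integrable_add[OF assms]
    by (intro integral_mono norm_add_square_le) (auto simp: square_integrable_def)
  then show ?thesis using assms by (simp add: square_integrable_def)
qed

lemma square_integrable_mult:
  "square_integrable M f \<Longrightarrow> square_integrable M (\<lambda>x. c * f x)"
  by (auto simp: square_integrable_def norm_mult power_mult_distrib)

lemma square_integrable_diff:
  "square_integrable M f \<Longrightarrow> square_integrable M g \<Longrightarrow> square_integrable M (\<lambda>x. f x - g x)"
  using square_integrable_add[of M f "\<lambda>x. (-1) * g x"] square_integrable_mult[of M g "-1"] by simp

lemma square_integrable_sum:
  "finite F \<Longrightarrow> (\<And>i. i \<in> F \<Longrightarrow> square_integrable M (f i)) \<Longrightarrow>
    square_integrable M (\<lambda>x. \<Sum>i\<in>F. f i x)"
proof (induction F rule: finite_induct)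
  case empty
  then show ?case by (simp add: square_integrable_def)
qed (simp add: square_integrable_add)

lemma (in finite_measure) square_integrable_bounded:
  assumes "f \<in> borel_measurable M" "\<And>x. cmod (f x) \<le> B"
  shows "square_integrable M f"
  unfolding square_integrable_def using assms(1)
  by (auto intro!: integrable_const_bound[where B="B\<^sup>2"] AE_I2 power_mono assms(2))

text \<open>Squared distances replace \<open>L2_norm\<close>; as \<open>\<epsilon>\<close> is
  arbitrary, this is the same density condition as in \<open>orthonormal_basis_L2\<close>.\<close>

definition L2_closed_span :: "'a measure \<Rightarrow> 'i set \<Rightarrow> ('i \<Rightarrow> 'a \<Rightarrow> complex) \<Rightarrow> ('a \<Rightarrow> complex) set" where
  "L2_closed_span M I e = {f. square_integrable M f \<and>
     (\<forall>\<epsilon>>0. \<exists>F c. finite F \<and> F \<subseteq> I \<and> (\<integral>x. (cmod (f x - (\<Sum>i\<in>F. c i * e i x)))\<^sup>2 \<partial>M) < \<epsilon>)}"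

section \<open>Closure properties of the closed span\<close>

context
  fixes M :: "'a measure" and I :: "'i set" and e :: "'i \<Rightarrow> 'a \<Rightarrow> complex"
  assumes e: "\<And>i. i \<in> I \<Longrightarrow> square_integrable M (e i)"
begin

lemma square_integrable_lincomb:
  "finite F \<Longrightarrow> F \<subseteq> I \<Longrightarrow> square_integrable M (\<lambda>x. \<Sum>i\<in>F. c i * e i x)"
  by (intro square_integrable_sum square_integrable_mult e) auto

lemma L2_closed_span_add:
  assumes "f \<in> L2_closed_span M I e" "g \<in> L2_closed_span M I e"
  shows "(\<lambda>x. f x + g x) \<in> L2_closed_span M I e"
proof -
  have f: "square_integrable M f" and g: "square_integrable M g"
    using assms by (auto simp: L2_closed_span_def)
  have "\<exists>F c. finite F \<and> F \<subseteq> I \<and> (\<integral>x. (cmod (f x + g x - (\<Sum>i\<in>F. c i * e i x)))\<^sup>2 \<partial>M) < \<epsilon>"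
    if "\<epsilon> > 0" for \<epsilon> :: real
  proof -
    have "\<epsilon> / 4 > 0" using that by simp
    obtain F c where
      F: "finite F" "F \<subseteq> I" "(\<integral>x. (cmod (f x - (\<Sum>i\<in>F. c i * e i x)))\<^sup>2 \<partial>M) < \<epsilon> / 4"
      using assms(1) \<open>\<epsilon> / 4 > 0\<close> unfolding L2_closed_span_def by blast
    obtain G d where
      G: "finite G" "G \<subseteq> I" "(\<integral>x. (cmod (g x - (\<Sum>i\<in>G. d i * e i x)))\<^sup>2 \<partial>M) < \<epsilon> / 4"
      using assms(2) \<open>\<epsilon> / 4 > 0\<close> unfolding L2_closed_span_def by blast
    define h where "h i = (if i \<in> F then c i else 0) + (if i \<in> G then d i else 0)" for i
    have "(\<Sum>i\<in>F \<union> G. h i * e i x) = (\<Sum>i\<in>F. c i * e i x) + (\<Sum>i\<in>G. d i * e i x)" for x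
    proof -
      have "(\<Sum>i\<in>F \<union> G. (if i \<in> F then c i else 0) * e i x) = (\<Sum>i\<in>F. c i * e i x)"
        "(\<Sum>i\<in>F \<union> G. (if i \<in> G then d i else 0) * e i x) = (\<Sum>i\<in>G. d i * e i x)"
        using F G by (auto intro!: sum.mono_neutral_cong_right)
      then show ?thesis by (simp only: h_def distrib_right sum.distrib)
    qed
    then have eq: "f x + g x - (\<Sum>i\<in>F \<union> G. h i * e i x) =
        (f x - (\<Sum>i\<in>F. c i * e i x)) + (g x - (\<Sum>i\<in>G. d i * e i x))" for x
      by simp
    have "(\<integral>x. (cmod (f x + g x - (\<Sum>i\<in>F \<union> G. h i * e i x)))\<^sup>2 \<partial>M)
        \<le> 2 * (\<integral>x. (cmod (f x - (\<Sum>i\<in>F. c i * e i x)))\<^sup>2 \<partial>M)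
          + 2 * (\<integral>x. (cmod (g x - (\<Sum>i\<in>G. d i * e i x)))\<^sup>2 \<partial>M)"
      unfolding eq using F G f g
      by (intro integral_norm_add_square_le square_integrable_diff square_integrable_lincomb)
    also have "\<dots> < \<epsilon>" using F(3) G(3) by linarith
    finally have "(\<integral>x. (cmod (f x + g x - (\<Sum>i\<in>F \<union> G. h i * e i x)))\<^sup>2 \<partial>M) < \<epsilon>" .
    with F(1,2) G(1,2) show ?thesis by (meson finite_UnI Un_least)
  qed
  then show ?thesis
    using f g by (simp add: L2_closed_span_def square_integrable_add)
qed

lemma L2_closed_span_mult:
  assumes "f \<in> L2_closed_span M I e"
  shows "(\<lambda>x. k * f x) \<in> L2_closed_span M I e"
proof (cases "k = 0")
  case True
  then show ?thesis
    by (auto simp: L2_closed_span_def square_integrable_def intro!: exI[of _ "{}"])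
next
  case False
  have f: "square_integrable M f" using assms by (auto simp: L2_closed_span_def)
  have "\<exists>F c. finite F \<and> F \<subseteq> I \<and> (\<integral>x. (cmod (k * f x - (\<Sum>i\<in>F. c i * e i x)))\<^sup>2 \<partial>M) < \<epsilon>"
    if "\<epsilon> > 0" for \<epsilon> :: real
  proof -
    have "\<epsilon> / (cmod k)\<^sup>2 > 0" using that False by simp
    then obtain F c where
      F: "finite F" "F \<subseteq> I" "(\<integral>x. (cmod (f x - (\<Sum>i\<in>F. c i * e i x)))\<^sup>2 \<partial>M) < \<epsilon> / (cmod k)\<^sup>2"
      using assms unfolding L2_closed_span_def by blast
    have "k * f x - (\<Sum>i\<in>F. (k * c i) * e i x) = k * (f x - (\<Sum>i\<in>F. c i * e i x))" for x
      by (simp add: right_diff_distrib sum_distrib_left mult.assoc)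
    then have "(\<integral>x. (cmod (k * f x - (\<Sum>i\<in>F. (k * c i) * e i x)))\<^sup>2 \<partial>M) =
        (cmod k)\<^sup>2 * (\<integral>x. (cmod (f x - (\<Sum>i\<in>F. c i * e i x)))\<^sup>2 \<partial>M)"
      by (simp only: norm_mult power_mult_distrib integral_mult_right_zero)
    also have "\<dots> < \<epsilon>" using F(3) False by (simp add: field_simps)
    finally have "(\<integral>x. (cmod (k * f x - (\<Sum>i\<in>F. (k * c i) * e i x)))\<^sup>2 \<partial>M) < \<epsilon>" .
    with F(1,2) show ?thesis
      by (intro exI[of _ F] exI[of _ "\<lambda>i. k * c i"] conjI)
  qed
  then show ?thesis
    using f by (simp add: L2_closed_span_def square_integrable_mult)
qed

lemma L2_closed_span_zero: "(\<lambda>x. 0) \<in> L2_closed_span M I e"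
  by (auto simp: L2_closed_span_def square_integrable_def intro!: exI[of _ "{}"])

lemma L2_closed_span_sum:
  assumes "finite F" "\<And>i. i \<in> F \<Longrightarrow> f i \<in> L2_closed_span M I e"
  shows "(\<lambda>x. \<Sum>i\<in>F. f i x) \<in> L2_closed_span M I e"
  using assms
  by (induction F rule: finite_induct) (simp_all add: L2_closed_span_zero L2_closed_span_add)

lemma L2_closed_span_closed:
  assumes f: "square_integrable M f"
    and approx: "\<And>\<epsilon>. \<epsilon> > 0 \<Longrightarrow> \<exists>g\<in>L2_closed_span M I e. (\<integral>x. (cmod (f x - g x))\<^sup>2 \<partial>M) < \<epsilon>"
  shows "f \<in> L2_closed_span M I e"
proof -
  have "\<exists>F c. finite F \<and> F \<subseteq> I \<and> (\<integral>x. (cmod (f x - (\<Sum>i\<in>F. c i * e i x)))\<^sup>2 \<partial>M) < \<epsilon>"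
    if "\<epsilon> > 0" for \<epsilon> :: real
  proof -
    have "\<epsilon> / 4 > 0" using that by simp
    from approx[OF this] obtain g where g: "g \<in> L2_closed_span M I e"
      "(\<integral>x. (cmod (f x - g x))\<^sup>2 \<partial>M) < \<epsilon> / 4" by blast
    then obtain F c where
      F: "finite F" "F \<subseteq> I" "(\<integral>x. (cmod (g x - (\<Sum>i\<in>F. c i * e i x)))\<^sup>2 \<partial>M) < \<epsilon> / 4"
      using \<open>\<epsilon> / 4 > 0\<close> unfolding L2_closed_span_def by blast
    have eq: "f x - (\<Sum>i\<in>F. c i * e i x) = (f x - g x) + (g x - (\<Sum>i\<in>F. c i * e i x))" for x
      by simp
    have "square_integrable M g" using g by (simp add: L2_closed_span_def)
    then have "(\<integral>x. (cmod (f x - (\<Sum>i\<in>F. c i * e i x)))\<^sup>2 \<partial>M)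
        \<le> 2 * (\<integral>x. (cmod (f x - g x))\<^sup>2 \<partial>M)
          + 2 * (\<integral>x. (cmod (g x - (\<Sum>i\<in>F. c i * e i x)))\<^sup>2 \<partial>M)"
      unfolding eq using F f
      by (intro integral_norm_add_square_le square_integrable_diff square_integrable_lincomb)
    also have "\<dots> < \<epsilon>" using F(3) g(2) by linarith
    finally have "(\<integral>x. (cmod (f x - (\<Sum>i\<in>F. c i * e i x)))\<^sup>2 \<partial>M) < \<epsilon>" .
    then show ?thesis using F by blast
  qed
  then show ?thesis using f by (simp add: L2_closed_span_def)
qed

text \<open>The limit inherits the bound \<open>h\<close>, so the squared differences are dominated
  by \<open>4 * h\<close> and dominated convergence gives convergence in L2.\<close>

lemma L2_closed_span_LIMSEQ:
  assumes s: "\<And>n::nat. s n \<in> L2_closed_span M I e"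
    and [measurable]: "f \<in> borel_measurable M"
    and lim: "\<And>x. x \<in> space M \<Longrightarrow> (\<lambda>n. s n x) \<longlonglongrightarrow> f x"
    and h: "integrable M h" and bound: "\<And>n x. x \<in> space M \<Longrightarrow> (cmod (s n x))\<^sup>2 \<le> h x"
  shows "f \<in> L2_closed_span M I e"
proof (rule L2_closed_span_closed)
  have [measurable]: "s n \<in> borel_measurable M" for n
    using s[of n] by (simp add: L2_closed_span_def square_integrable_def)
  have f_le: "(cmod (f x))\<^sup>2 \<le> h x" if "x \<in> space M" for x
    by (rule LIMSEQ_le_const2[where X="\<lambda>n. (cmod (s n x))\<^sup>2"])
      (use lim[OF that] bound[OF that] in \<open>auto intro!: tendsto_intros\<close>)
  then show "square_integrable M f"
    unfolding square_integrable_def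
    by (auto intro!: Bochner_Integration.integrable_bound[OF h] AE_I2 order_trans[OF f_le])
  have "(\<lambda>n. \<integral>x. (cmod (f x - s n x))\<^sup>2 \<partial>M) \<longlonglongrightarrow> (\<integral>x. 0 \<partial>M)"
  proof (rule integral_dominated_convergence)
    show "integrable M (\<lambda>x. 4 * h x)" using h by simp
    show "AE x in M. (\<lambda>n. (cmod (f x - s n x))\<^sup>2) \<longlonglongrightarrow> 0"
    proof (rule AE_I2)
      fix x assume "x \<in> space M"
      have "(\<lambda>n. (cmod (f x - s n x))\<^sup>2) \<longlonglongrightarrow> (cmod (f x - f x))\<^sup>2"
        by (intro tendsto_intros lim \<open>x \<in> space M\<close>)
      then show "(\<lambda>n. (cmod (f x - s n x))\<^sup>2) \<longlonglongrightarrow> 0" by simp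
    qed
    show "AE x in M. norm ((cmod (f x - s n x))\<^sup>2) \<le> 4 * h x" for n
    proof (rule AE_I2)
      fix x assume x: "x \<in> space M"
      have "(cmod (f x - s n x))\<^sup>2 \<le> 2 * (cmod (f x))\<^sup>2 + 2 * (cmod (s n x))\<^sup>2"
        using norm_add_square_le[of "f x" "- s n x"] by simp
      then show "norm ((cmod (f x - s n x))\<^sup>2) \<le> 4 * h x"
        using f_le[OF x] bound[OF x, of n] by simp
    qed
  qed auto
  then have lim0: "(\<lambda>n. \<integral>x. (cmod (f x - s n x))\<^sup>2 \<partial>M) \<longlonglongrightarrow> 0" by simp
  fix \<epsilon> :: real assume "\<epsilon> > 0"
  then have "\<forall>\<^sub>F n in sequentially. (\<integral>x. (cmod (f x - s n x))\<^sup>2 \<partial>M) < \<epsilon>"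
    by (rule order_tendstoD(2)[OF lim0])
  then show "\<exists>g\<in>L2_closed_span M I e. (\<integral>x. (cmod (f x - g x))\<^sup>2 \<partial>M) < \<epsilon>"
    using s by (auto simp: eventually_sequentially)
qed

text \<open>Simple functions are combinations of indicators, and every square-integrable function is
  a pointwise limit of simple functions bounded by twice its modulus.\<close>

lemma L2_closed_span_all:
  assumes ind: "\<And>A. A \<in> sets M \<Longrightarrow> (\<lambda>x. indicator A x) \<in> L2_closed_span M I e"
    and f: "square_integrable M f"
  shows "f \<in> L2_closed_span M I e"
proof -
  have fm: "f \<in> borel_measurable M" using f by (simp add: square_integrable_def)
  obtain s where s: "\<And>i::nat. simple_function M (s i)"
    "\<And>x. x \<in> space M \<Longrightarrow> (\<lambda>i. s i x) \<longlonglongrightarrow> f x"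
    "\<And>i x. x \<in> space M \<Longrightarrow> cmod (s i x) \<le> 2 * cmod (f x)"
    using borel_measurable_implies_sequence_metric[OF fm, of 0] by (simp add: dist_norm) metis
  have "s i \<in> L2_closed_span M I e" for i
  proof -
    define t where "t x = (\<Sum>y\<in>s i ` space M. y * indicator (s i -` {y} \<inter> space M) x)" for x
    have "t \<in> L2_closed_span M I e"
      unfolding t_def using s(1)[of i]
      by (intro L2_closed_span_sum L2_closed_span_mult ind)
        (auto simp: simple_function_def)
    \<comment> \<open>Equality holds only on \<open>space M\<close>, so membership is transferred
      through congruence of integrals, with measurability of \<open>s i\<close> supplied
      separately.\<close>
    moreover have "s i x = t x" if "x \<in> space M" for x
      unfolding simple_function_indicator_representation_banach[OF s(1) that] t_def
      by (auto intro!: sum.cong simp: scaleR_conv_of_real indicator_def)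
    moreover have "s i \<in> borel_measurable M"
      using s(1) by (rule borel_measurable_simple_function)
    ultimately show ?thesis
      unfolding L2_closed_span_def square_integrable_def
      by (simp cong: Bochner_Integration.integrable_cong Bochner_Integration.integral_cong)
  qed
  then show ?thesis
  proof (rule L2_closed_span_LIMSEQ[OF _ fm s(2)])
    show "integrable M (\<lambda>x. 4 * (cmod (f x))\<^sup>2)" using f by (simp add: square_integrable_def)
    show "(cmod (s i x))\<^sup>2 \<le> 4 * (cmod (f x))\<^sup>2" if "x \<in> space M" for i x
      using power_mono[OF s(3)[OF that, of i], of 2] by (simp add: power_mult_distrib)
  qed
qed

end

section \<open>Completeness of exponentials\<close>

definition fourier_exp :: "real \<Rightarrow> real \<Rightarrow> complex" where
  "fourier_exp l x = exp (2 * complex_of_real pi * \<i> * complex_of_real l * complex_of_real x)"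

lemma fourier_exp_iexp: "fourier_exp l x = iexp (2 * pi * l * x)"
  by (simp add: fourier_exp_def mult_ac)

lemma fourier_exp_cis: "fourier_exp l x = cis (2 * pi * l * x)"
  by (simp add: fourier_exp_iexp cis_conv_exp)

lemma norm_fourier_exp [simp]: "cmod (fourier_exp l x) = 1"
  by (simp add: fourier_exp_cis)

lemma fourier_exp_add: "fourier_exp (a + b) x = fourier_exp a x * fourier_exp b x"
  by (simp add: fourier_exp_cis cis_mult algebra_simps)

lemma cnj_fourier_exp: "cnj (fourier_exp l x) = fourier_exp (- l) x"
  by (simp add: fourier_exp_cis cis_cnj)

lemma fourier_exp_measurable [measurable]: "fourier_exp l \<in> borel_measurable borel"
  unfolding fourier_exp_def by measurable

lemma char_eq_integral_fourier_exp: "char M (2 * pi * l) = (\<integral>x. fourier_exp l x \<partial>M)"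
  by (simp add: char_def fourier_exp_iexp)

lemma char_uminus: "char M (- t) = cnj (char M t)"
proof -
  have "char M (- t) = (\<integral>x. cnj (iexp (t * x)) \<partial>M)"
    unfolding char_def by (intro Bochner_Integration.integral_cong) (simp_all add: exp_cnj)
  then show ?thesis by (simp add: char_def)
qed

section \<open>Exponentials in L2 of a probability measure on the line\<close>

context real_distribution
begin

lemma integrable_fourier_exp: "integrable M (fourier_exp l)"
  by (rule integrable_const_bound[where B=1]) auto

lemma square_integrable_fourier_exp: "square_integrable M (fourier_exp l)"
  by (rule square_integrable_bounded[where B=1]) auto

text \<open>The equality case of Bessel's inequality: \<open>char M (2 * pi * (\<xi> - l))\<close>
  is the inner product of the exponentials with frequencies \<open>\<xi>\<close> and
  \<open>l\<close>, hence the coefficient of the orthogonal projection.\<close>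

lemma integral_dist_fourier_exp:
  fixes \<xi> :: real and F :: "real set"
  assumes fin: "finite F"
    and orth: "\<And>l l'. l \<in> F \<Longrightarrow> l' \<in> F \<Longrightarrow> l \<noteq> l' \<Longrightarrow> char M (2 * pi * (l - l')) = 0"
  shows "(\<integral>x. (cmod (fourier_exp \<xi> x - (\<Sum>l\<in>F. char M (2 * pi * (\<xi> - l)) * fourier_exp l x)))\<^sup>2 \<partial>M)
    = 1 - (\<Sum>l\<in>F. (cmod (char M (2 * pi * (\<xi> - l))))\<^sup>2)"
proof -
  define a where "a l = char M (2 * pi * l)" for l
  have a: "(\<integral>x. fourier_exp l x \<partial>M) = a l" for l
    by (simp add: a_def char_eq_integral_fourier_exp)
  have a_neg: "a (- l) = cnj (a l)" for l by (simp add: a_def char_uminus flip: minus_mult_right)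
  have a0: "a 0 = 1" by (simp add: a_def char_zero)
  have a_orth: "a (l - l') = of_bool (l = l')" if "l \<in> F" "l' \<in> F" for l l'
    using orth that a0 by (auto simp: a_def)
  have pt: "complex_of_real ((cmod (fourier_exp \<xi> x - (\<Sum>l\<in>F. a (\<xi> - l) * fourier_exp l x)))\<^sup>2) =
      fourier_exp 0 x - (\<Sum>l\<in>F. cnj (a (\<xi> - l)) * fourier_exp (\<xi> - l) x)
      - (\<Sum>l\<in>F. a (\<xi> - l) * fourier_exp (l - \<xi>) x)
      + (\<Sum>l\<in>F. \<Sum>l'\<in>F. a (\<xi> - l) * cnj (a (\<xi> - l')) * fourier_exp (l - l') x)" for x
  proof -
    have "complex_of_real ((cmod (fourier_exp \<xi> x - (\<Sum>l\<in>F. a (\<xi> - l) * fourier_exp l x)))\<^sup>2) =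
      (fourier_exp \<xi> x - (\<Sum>l\<in>F. a (\<xi> - l) * fourier_exp l x)) *
      (fourier_exp (- \<xi>) x - (\<Sum>l\<in>F. cnj (a (\<xi> - l)) * fourier_exp (- l) x))"
      unfolding complex_norm_square by (simp add: cnj_fourier_exp)
    also have "\<dots> = fourier_exp \<xi> x * fourier_exp (- \<xi>) x
        - (\<Sum>l\<in>F. cnj (a (\<xi> - l)) * (fourier_exp \<xi> x * fourier_exp (- l) x))
        - (\<Sum>l\<in>F. a (\<xi> - l) * (fourier_exp l x * fourier_exp (- \<xi>) x))
        + (\<Sum>l\<in>F. \<Sum>l'\<in>F. a (\<xi> - l) * cnj (a (\<xi> - l')) * (fourier_exp l x * fourier_exp (- l') x))"
    proof -
      have diff_mult: "(p - s) * (q - t) = p * q - p * t - s * q + s * t" for p q s t :: complex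
        by (simp add: algebra_simps)
      show ?thesis
        unfolding diff_mult sum_product unfolding sum_distrib_left sum_distrib_right by (simp only: mult_ac)
    qed
    finally show ?thesis by (simp flip: fourier_exp_add)
  qed
  have "complex_of_real (\<integral>x. (cmod (fourier_exp \<xi> x - (\<Sum>l\<in>F. a (\<xi> - l) * fourier_exp l x)))\<^sup>2 \<partial>M)
     = (\<integral>x. fourier_exp 0 x - (\<Sum>l\<in>F. cnj (a (\<xi> - l)) * fourier_exp (\<xi> - l) x)
      - (\<Sum>l\<in>F. a (\<xi> - l) * fourier_exp (l - \<xi>) x)
      + (\<Sum>l\<in>F. \<Sum>l'\<in>F. a (\<xi> - l) * cnj (a (\<xi> - l')) * fourier_exp (l - l') x) \<partial>M)"
    unfolding integral_complex_of_real[symmetric] pt ..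
  also have "\<dots> = 1 - (\<Sum>l\<in>F. cnj (a (\<xi> - l)) * a (\<xi> - l)) - (\<Sum>l\<in>F. a (\<xi> - l) * a (l - \<xi>))
      + (\<Sum>l\<in>F. \<Sum>l'\<in>F. a (\<xi> - l) * cnj (a (\<xi> - l')) * a (l - l'))"
    by (simp add: integrable_fourier_exp a a0 Bochner_Integration.integral_sum)
  \<comment> \<open>Orthogonality leaves only the diagonal. The three sums then all equal the sum of
    squared coefficients, with signs -, - and +.\<close>
  also have "(\<Sum>l\<in>F. \<Sum>l'\<in>F. a (\<xi> - l) * cnj (a (\<xi> - l')) * a (l - l'))
      = (\<Sum>l\<in>F. a (\<xi> - l) * cnj (a (\<xi> - l)))"
    using fin by (intro sum.cong refl) (simp add: a_orth sum.delta' of_bool_def if_distrib cong: if_cong sum.cong)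
  also have "(\<Sum>l\<in>F. a (\<xi> - l) * a (l - \<xi>)) = (\<Sum>l\<in>F. a (\<xi> - l) * cnj (a (\<xi> - l)))"
    by (intro sum.cong refl) (simp flip: a_neg)
  also have "1 - (\<Sum>l\<in>F. cnj (a (\<xi> - l)) * a (\<xi> - l)) - (\<Sum>l\<in>F. a (\<xi> - l) * cnj (a (\<xi> - l)))
      + (\<Sum>l\<in>F. a (\<xi> - l) * cnj (a (\<xi> - l))) = of_real (1 - (\<Sum>l\<in>F. (cmod (a (\<xi> - l)))\<^sup>2))"
    by (simp add: mult.commute flip: complex_norm_square)
  finally have "(\<integral>x. (cmod (fourier_exp \<xi> x - (\<Sum>l\<in>F. a (\<xi> - l) * fourier_exp l x)))\<^sup>2 \<partial>M)
    = 1 - (\<Sum>l\<in>F. (cmod (a (\<xi> - l)))\<^sup>2)"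
    unfolding of_real_eq_iff .
  then show ?thesis by (simp only: a_def)
qed

lemma L2_closed_span_continuous:
  fixes \<Lambda> :: "real set" and g :: "real \<Rightarrow> real"
  assumes supp: "AE x in M. x \<in> {0..1}"
    and exps: "\<And>\<xi>. fourier_exp \<xi> \<in> L2_closed_span M \<Lambda> fourier_exp"
    and g: "continuous_on UNIV g" "\<And>x. \<bar>g x\<bar> \<le> 1"
  shows "(\<lambda>x. complex_of_real (g x)) \<in> L2_closed_span M \<Lambda> fourier_exp"
proof (rule L2_closed_span_closed)
  have [measurable]: "g \<in> borel_measurable borel"
    using g(1) by (rule borel_measurable_continuous_onI)
  show gsq: "square_integrable M (\<lambda>x. complex_of_real (g x))"
    by (rule square_integrable_bounded[where B=1]) (use g(2) in auto)
  \<comment> \<open>The frequency is generalised in the induction because, by Euler's formula, each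
    factor \<open>cos (pi * x)\<close> shifts it by 1/2 in both directions.\<close>
  have cos_pow: "(\<lambda>x. complex_of_real (cos (pi * x) ^ k) * fourier_exp \<xi> x)
      \<in> L2_closed_span M \<Lambda> fourier_exp" for k \<xi>
  proof (induction k arbitrary: \<xi>)
    case (Suc k)
    have cos_eq: "complex_of_real (cos (pi * x)) = 1/2 * (fourier_exp (1/2) x + fourier_exp (-1/2) x)" for x
      by (simp add: fourier_exp_cis complex_eq_iff)
    have "(\<lambda>x. complex_of_real (cos (pi * x) ^ Suc k) * fourier_exp \<xi> x) =
      (\<lambda>x. 1/2 * (complex_of_real (cos (pi * x) ^ k) * fourier_exp (1/2 + \<xi>) x
        + complex_of_real (cos (pi * x) ^ k) * fourier_exp (-1/2 + \<xi>) x))"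
      unfolding power_Suc of_real_mult cos_eq fourier_exp_add by (auto simp: algebra_simps)
    also have "\<dots> \<in> L2_closed_span M \<Lambda> fourier_exp"
      by (intro L2_closed_span_mult L2_closed_span_add Suc.IH square_integrable_fourier_exp)
    finally show ?case .
  qed (simp add: exps)
  \<comment> \<open>\<open>x \<mapsto> cos (\<pi> x)\<close> is injective on \<open>[0, 1]\<close>, so there \<open>g\<close> is a continuous function of \<open>cos (\<pi> x)\<close>, and
    polynomials in \<open>cos (\<pi> x)\<close> are trigonometric polynomials with half-integer frequencies.\<close>
  fix \<epsilon> :: real assume "\<epsilon> > 0"
  \<comment> \<open>The cap at 1 ensures that the square of \<open>\<eta>\<close> is at most
    \<open>\<eta>\<close>.\<close>
  define \<eta> where "\<eta> = min 1 (\<epsilon> / 2)"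
  have \<eta>: "0 < \<eta>" "\<eta> \<le> 1" "\<eta> < \<epsilon>" using \<open>\<epsilon> > 0\<close> by (auto simp: \<eta>_def)
  have "continuous_on {-1..1} (\<lambda>y. g (arccos y / pi))"
    by (intro continuous_on_compose2[OF g(1)] continuous_intros) auto
  then obtain p where p: "real_polynomial_function p"
    "\<And>y. y \<in> {-1..1} \<Longrightarrow> \<bar>g (arccos y / pi) - p y\<bar> < \<eta>"
    using Stone_Weierstrass_real_polynomial_function[of "{-1..1::real}" _ \<eta>] \<eta> by blast
  then obtain a n where pa: "p = (\<lambda>y. \<Sum>i\<le>n. a i * y ^ i)"
    by (auto simp: real_polynomial_function_iff_sum)
  define h where "h x = complex_of_real (p (cos (pi * x)))" for x
  have "h = (\<lambda>x. \<Sum>i\<le>n. complex_of_real (a i) * (complex_of_real (cos (pi * x) ^ i) * fourier_exp 0 x))"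
    by (auto simp: h_def pa fourier_exp_def)
  also have "\<dots> \<in> L2_closed_span M \<Lambda> fourier_exp"
    by (intro L2_closed_span_sum L2_closed_span_mult cos_pow square_integrable_fourier_exp) auto
  finally have h: "h \<in> L2_closed_span M \<Lambda> fourier_exp" .
  have close: "(cmod (g x - h x))\<^sup>2 \<le> \<eta>" if "x \<in> {0..1}" for x
  proof -
    have "arccos (cos (pi * x)) = pi * x"
      using that by (intro arccos_cos) (auto simp: mult_left_le)
    then have "\<bar>g x - p (cos (pi * x))\<bar> < \<eta>" using p(2)[of "cos (pi * x)"] by simp
    then have "(cmod (g x - h x))\<^sup>2 \<le> \<eta>\<^sup>2"
      unfolding h_def of_real_diff[symmetric] norm_of_real by (intro power_mono) auto
    also have "\<dots> \<le> \<eta>" using \<eta> by (simp add: power2_eq_square mult_left_le)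
    finally show ?thesis .
  qed
  have "square_integrable M (\<lambda>x. complex_of_real (g x) - h x)"
    using gsq h by (intro square_integrable_diff) (auto simp: L2_closed_span_def)
  then have "(\<integral>x. (cmod (g x - h x))\<^sup>2 \<partial>M) \<le> (\<integral>x. \<eta> \<partial>M)"
    by (intro integral_mono_AE) (use supp close in \<open>auto simp: square_integrable_def\<close>)
  also have "\<dots> < \<epsilon>" using \<eta> prob_space by simp
  finally show "\<exists>h\<in>L2_closed_span M \<Lambda> fourier_exp. (\<integral>x. (cmod (g x - h x))\<^sup>2 \<partial>M) < \<epsilon>"
    using h by blast
qed (rule square_integrable_fourier_exp)

text \<open>Sets whose indicator lies in the span form a Dynkin system. It contains the closed
  half-lines, a generator stable under intersection, because their indicators are limits of
  continuous ramps.\<close>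

lemma L2_closed_span_indicator:
  fixes \<Lambda> :: "real set"
  assumes cont: "\<And>g. continuous_on UNIV g \<Longrightarrow> (\<And>x. \<bar>g x\<bar> \<le> 1) \<Longrightarrow>
      (\<lambda>x. complex_of_real (g x)) \<in> L2_closed_span M \<Lambda> fourier_exp"
    and A: "A \<in> sets borel"
  shows "(\<lambda>x. indicator A x) \<in> L2_closed_span M \<Lambda> fourier_exp"
proof -
  note sq = square_integrable_fourier_exp
  have gen: "sets borel = sigma_sets UNIV (range (\<lambda>a::real. {..a}))"
    by (subst borel_eq_atMost) simp
  have "Int_stable (range (\<lambda>a::real. {..a}))" by (auto simp: Int_stable_def)
  moreover have "range (\<lambda>a::real. {..a}) \<subseteq> Pow UNIV" by simp
  moreover have "A \<in> sigma_sets UNIV (range (\<lambda>a::real. {..a}))" using A gen by simp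
  ultimately show ?thesis
  proof (induction rule: sigma_sets_induct_disjoint)
    case (basic A)
    then obtain a where A: "A = {..a}" by auto
    \<comment> \<open>For positive \<open>n\<close> the ramp is 1 up to \<open>a\<close> and falls
      linearly to 0 at \<open>a + 1/n\<close>.\<close>
    define s where "s n x = max 0 (min 1 (1 - real n * (x - a)))" for n :: nat and x
    show ?case
    proof (rule L2_closed_span_LIMSEQ[OF sq, where s="\<lambda>n x. complex_of_real (s n x)" and h="\<lambda>_. 1"])
      show "(\<lambda>x. complex_of_real (s n x)) \<in> L2_closed_span M \<Lambda> fourier_exp" for n
        by (intro cont) (auto simp: s_def intro!: continuous_intros)
      show "indicator A \<in> borel_measurable M" unfolding A by measurable
      show "(\<lambda>n. complex_of_real (s n x)) \<longlonglongrightarrow> indicator A x" for x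
      proof (cases "x \<le> a")
        case True
        then have "s n x = 1" for n by (simp add: s_def mult_nonneg_nonpos)
        then show ?thesis using True by (simp add: A)
      next
        case False
        have "\<forall>\<^sub>F n in sequentially. s n x = 0"
        proof -
          obtain n0 where n0: "1 / (x - a) \<le> real n0" using real_arch_simple by blast
          have "s n x = 0" if "n \<ge> n0" for n
          proof -
            have "1 / (x - a) \<le> real n" using n0 that by linarith
            then show ?thesis using False by (simp add: s_def field_simps)
          qed
          then show ?thesis by (auto simp: eventually_sequentially)
        qed
        then have "\<forall>\<^sub>F n in sequentially. complex_of_real (s n x) = 0" by eventually_elim simp
        then show ?thesis using False by (simp add: A tendsto_eventually)
      qed
      show "(cmod (complex_of_real (s n x)))\<^sup>2 \<le> 1" for n x
        by (simp add: s_def power_le_one)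
    qed simp
  next
    case empty
    then show ?case using L2_closed_span_zero[OF sq] by simp
  next
    case (compl A)
    have "(\<lambda>x. complex_of_real 1 + (-1) * indicator A x) \<in> L2_closed_span M \<Lambda> fourier_exp"
      by (intro L2_closed_span_add L2_closed_span_mult cont compl.IH sq) auto
    moreover have "(\<lambda>x. complex_of_real 1 + (-1) * indicator A x) = (\<lambda>x. indicator (UNIV - A) x)"
      by (auto simp: indicator_def)
    ultimately show ?case by simp
  next
    case (union A)
    have meas: "A i \<in> sets borel" for i using union(2) gen by blast
    show ?case
    proof (rule L2_closed_span_LIMSEQ[OF sq, where h="\<lambda>_. 1"
          and s="\<lambda>n x. \<Sum>i<n. indicator (A i) x"])
      show "(\<lambda>x. \<Sum>i<n. indicator (A i) x) \<in> L2_closed_span M \<Lambda> fourier_exp" for n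
        by (intro L2_closed_span_sum union sq) auto
      show "indicator (\<Union> (range A)) \<in> borel_measurable M"
        using meas by (intro borel_measurable_indicator) auto
      have eq: "(\<Sum>i<n. indicator (A i) x) = (indicator (\<Union>i<n. A i) x :: complex)" for n x
        using union(1) by (intro indicator_UN_disjoint[symmetric])
          (auto simp: disjoint_family_on_def)
      show "(cmod (\<Sum>i<n. indicator (A i) x))\<^sup>2 \<le> 1" for n x
        unfolding eq by (auto simp: indicator_def)
      show "(\<lambda>n. \<Sum>i<n. indicator (A i) x) \<longlonglongrightarrow> (indicator (\<Union> (range A)) x :: complex)" for x
        unfolding eq by (rule LIMSEQ_indicator_UN)
    qed simp
  qed
qed

text \<open>Near-equality in Bessel's inequality puts every exponential into the closed span.
  Continuous functions bounded by 1, indicators and finally all square-integrable functions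
  follow.\<close>

lemma spectral_measureI:
  fixes \<Lambda> :: "real set"
  assumes supp: "AE x in M. x \<in> {0..1}"
    and \<Lambda>: "countable \<Lambda>"
    and orth: "\<And>l l'. l \<in> \<Lambda> \<Longrightarrow> l' \<in> \<Lambda> \<Longrightarrow> l \<noteq> l' \<Longrightarrow> char M (2 * pi * (l - l')) = 0"
    and parseval: "\<And>\<xi> \<epsilon>. \<epsilon> > 0 \<Longrightarrow> \<exists>F. finite F \<and> F \<subseteq> \<Lambda> \<and>
      (\<Sum>l\<in>F. (cmod (char M (2 * pi * (\<xi> - l))))\<^sup>2) > 1 - \<epsilon>"
  shows "spectral_measure M"
proof -
  note sq = square_integrable_fourier_exp
  have exps: "fourier_exp \<xi> \<in> L2_closed_span M \<Lambda> fourier_exp" for \<xi>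
    unfolding L2_closed_span_def mem_Collect_eq
  proof (intro conjI allI impI sq)
    fix \<epsilon> :: real assume "\<epsilon> > 0"
    from parseval[OF this, of \<xi>] obtain F where F: "finite F" "F \<subseteq> \<Lambda>"
      "(\<Sum>l\<in>F. (cmod (char M (2 * pi * (\<xi> - l))))\<^sup>2) > 1 - \<epsilon>" by blast
    have "(\<integral>x. (cmod (fourier_exp \<xi> x - (\<Sum>l\<in>F. char M (2 * pi * (\<xi> - l)) * fourier_exp l x)))\<^sup>2 \<partial>M) < \<epsilon>"
      using F by (subst integral_dist_fourier_exp) (auto intro!: orth)
    then show "\<exists>F c. finite F \<and> F \<subseteq> \<Lambda> \<and>
        (\<integral>x. (cmod (fourier_exp \<xi> x - (\<Sum>l\<in>F. c l * fourier_exp l x)))\<^sup>2 \<partial>M) < \<epsilon>"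
      using F by (intro exI[of _ F] exI[of _ "\<lambda>l. char M (2 * pi * (\<xi> - l))"]) simp
  qed
  have all: "f \<in> L2_closed_span M \<Lambda> fourier_exp" if "square_integrable M f" for f
  proof (rule L2_closed_span_all[OF sq _ that])
    fix A assume "A \<in> sets M"
    then show "(\<lambda>x. indicator A x) \<in> L2_closed_span M \<Lambda> fourier_exp"
      using L2_closed_span_continuous[OF supp exps] by (intro L2_closed_span_indicator) auto
  qed
  have "orthonormal_basis_L2 M \<Lambda> fourier_exp"
    unfolding orthonormal_basis_L2_def
  proof (intro conjI ballI allI impI sq)
    fix l l' assume l: "l \<in> \<Lambda>" "l' \<in> \<Lambda>"
    have "L2_inner M (fourier_exp l) (fourier_exp l') = char M (2 * pi * (l - l'))"
      by (simp add: L2_inner_def cnj_fourier_exp char_eq_integral_fourier_exp flip: fourier_exp_add)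
    then show "L2_inner M (fourier_exp l) (fourier_exp l') = of_bool (l = l')"
      using orth[OF l] by (auto simp: char_zero)
  next
    fix f and \<epsilon> :: real assume "square_integrable M f" "\<epsilon> > 0"
    then have "f \<in> L2_closed_span M \<Lambda> fourier_exp" "\<epsilon>\<^sup>2 > 0" using all by auto
    then obtain F c where F: "finite F" "F \<subseteq> \<Lambda>"
      "(\<integral>x. (cmod (f x - (\<Sum>l\<in>F. c l * fourier_exp l x)))\<^sup>2 \<partial>M) < \<epsilon>\<^sup>2"
      unfolding L2_closed_span_def by blast
    then have "L2_norm M (\<lambda>x. f x - (\<Sum>l\<in>F. c l * fourier_exp l x)) < \<epsilon>"
      unfolding L2_norm_def using \<open>\<epsilon> > 0\<close> by (simp add: real_sqrt_less_iff real_less_lsqrt)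
    then show "\<exists>F c. finite F \<and> F \<subseteq> \<Lambda> \<and> L2_norm M (\<lambda>x. f x - (\<Sum>i\<in>F. c i * fourier_exp i x)) < \<epsilon>"
      using F by blast
  qed
  then show ?thesis
    unfolding spectral_measure_def fourier_exp_def[abs_def]
    using \<Lambda> real_distribution_axioms by blast
qed

end

section \<open>Infinite convolutions of compactly supported measures\<close>

lemma char_convolution:
  assumes "real_distribution A" "real_distribution B"
  shows "char (convolution A B) t = char A t * char B t"
proof -
  interpret A: real_distribution A by fact
  interpret B: real_distribution B by fact
  interpret P: pair_prob_space A B ..
  define f where "f z = iexp (t * fst z) * iexp (t * snd z)" for z :: "real \<times> real"
  have "char (convolution A B) t = (\<integral>z. f z \<partial>(A \<Otimes>\<^sub>M B))"
    by (simp add: char_def convolution_def integral_distr case_prod_beta f_def algebra_simps exp_add)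
  also have "\<dots> = (\<integral>x. (\<integral>y. f (x, y) \<partial>B) \<partial>A)"
    by (rule P.integral_fst'[symmetric])
      (auto intro!: P.integrable_const_bound[where B=1] AE_I2 simp: norm_mult f_def[abs_def])
  also have "\<dots> = char A t * char B t" by (simp add: char_def f_def)
  finally show ?thesis .
qed

lemma norm_iexp_diff_le: "cmod (iexp a - iexp b) \<le> \<bar>a - b\<bar>"
proof -
  have "iexp a - iexp b = iexp b * (iexp (a - b) - 1)"
    by (simp add: right_diff_distrib exp_diff)
  then have "cmod (iexp a - iexp b) = cmod (iexp (a - b) - 1)" by (simp add: norm_mult)
  also have "\<dots> \<le> \<bar>a - b\<bar>" using iexp_approx1[of "a - b" 0] by simp
  finally show ?thesis .
qed

text \<open>Integrating \<open>norm_iexp_diff_le\<close> bounds the increment by the largest value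
  of \<open>\<bar>s - t\<bar> * x\<close> on the support.\<close>

lemma (in real_distribution) char_lipschitz:
  assumes supp: "AE x in M. x \<in> {0..d}"
  shows "cmod (char M s - char M t) \<le> d * \<bar>s - t\<bar>"
proof -
  have int: "integrable M (\<lambda>x. iexp (u * x))" for u
    by (rule integrable_const_bound[where B=1]) auto
  have "cmod (char M s - char M t) = cmod (\<integral>x. iexp (s * x) - iexp (t * x) \<partial>M)"
    unfolding char_def by (subst Bochner_Integration.integral_diff[OF int int]) (rule refl)
  also have "\<dots> \<le> (\<integral>x. cmod (iexp (s * x) - iexp (t * x)) \<partial>M)" by (rule integral_norm_bound)
  also have "\<dots> \<le> (\<integral>x. d * \<bar>s - t\<bar> \<partial>M)"
  proof (rule integral_mono_AE)
    show "integrable M (\<lambda>x. cmod (iexp (s * x) - iexp (t * x)))"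
      by (intro integrable_norm Bochner_Integration.integrable_diff int)
    show "AE x in M. cmod (iexp (s * x) - iexp (t * x)) \<le> d * \<bar>s - t\<bar>"
      using supp
    proof eventually_elim
      case (elim x)
      have "cmod (iexp (s * x) - iexp (t * x)) \<le> \<bar>s - t\<bar> * x"
        using norm_iexp_diff_le[of "s * x" "t * x"] elim by (simp add: abs_mult flip: left_diff_distrib)
      also have "\<dots> \<le> d * \<bar>s - t\<bar>" using elim by (simp add: mult.commute mult_right_mono)
      finally show ?case .
    qed
  qed simp
  also have "\<dots> = d * \<bar>s - t\<bar>" using prob_space by simp
  finally show ?thesis .
qed

text \<open>Factor \<open>k\<close> lives on an interval of length \<open>d k\<close>. A common
  bound on the partial sums of the lengths yields both tightness and summable increments of the
  characteristic functions.\<close>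

locale bounded_convolution =
  fixes m :: "nat \<Rightarrow> real measure" and d :: "nat \<Rightarrow> real" and D :: real
  assumes m: "\<And>k. real_distribution (m k)"
    and supp: "\<And>k. AE x in m k. x \<in> {0..d k}"
    and d_nonneg: "\<And>k. 0 \<le> d k"
    and d_sum: "\<And>n. (\<Sum>k<n. d k) \<le> D"
begin

lemma char_finite_convolution: "char (finite_convolution m n) t = (\<Prod>k<n. char (m k) t)"
proof (induction n)
  case 0
  show ?case by (simp add: char_def integral_return)
next
  case (Suc n)
  then show ?case
    by (simp add: char_convolution real_distribution_finite_convolution m)
qed

lemma finite_convolution_supp: "AE x in finite_convolution m n. x \<in> {0..\<Sum>k<n. d k}"
proof (induction n)
  case 0
  show ?case unfolding finite_convolution.simps by (subst AE_return) auto
next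
  case (Suc n)
  interpret A: real_distribution "finite_convolution m n"
    by (rule real_distribution_finite_convolution[OF m])
  interpret B: real_distribution "m n" by (rule m)
  interpret P: pair_prob_space "finite_convolution m n" "m n" ..
  have "AE z in finite_convolution m n \<Otimes>\<^sub>M m n. fst z \<in> {0..\<Sum>k<n. d k} \<and> snd z \<in> {0..d n}"
  proof (rule P.AE_pair_measure)
    show "AE x in finite_convolution m n. AE y in m n.
        fst (x, y) \<in> {0..\<Sum>k<n. d k} \<and> snd (x, y) \<in> {0..d n}"
      using Suc
    proof eventually_elim
      case (elim x)
      show ?case using supp[of n] by eventually_elim (use elim in simp)
    qed
  qed measurable
  then have "AE z in finite_convolution m n \<Otimes>\<^sub>M m n. (\<lambda>(x, y). x + y) z \<in> {0..\<Sum>k<Suc n. d k}"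
    by eventually_elim (auto simp: case_prod_beta)
  then show ?case
    unfolding finite_convolution.simps convolution_def
    by (subst AE_distr_iff) (auto simp: case_prod_beta)
qed

lemma finite_convolution_supp_D: "AE x in finite_convolution m n. x \<in> {0..D}"
  using finite_convolution_supp[of n] by eventually_elim (use d_sum[of n] in auto)

text \<open>Since \<open>char (m n) 0 = 1\<close>, multiplying by the next factor changes the
  product by at most \<open>d n * \<bar>t\<bar>\<close>, which is summable.\<close>

lemma convergent_char: "convergent (\<lambda>n. char (finite_convolution m n) t)"
proof -
  let ?f = "\<lambda>n. char (finite_convolution m n) t"
  have "summable d"
    using d_nonneg d_sum by (rule summableI_nonneg_bounded)
  then have "summable (\<lambda>n. d n * \<bar>t\<bar>)" by (rule summable_mult2)
  moreover have "cmod (?f (Suc n) - ?f n) \<le> d n * \<bar>t\<bar>" for n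
  proof -
    interpret A: real_distribution "finite_convolution m n"
      by (rule real_distribution_finite_convolution[OF m])
    interpret B: real_distribution "m n" by (rule m)
    have "?f (Suc n) - ?f n = ?f n * (char (m n) t - char (m n) 0)"
      by (simp add: char_convolution A.real_distribution_axioms m B.char_zero right_diff_distrib)
    then have "cmod (?f (Suc n) - ?f n) = cmod (?f n) * cmod (char (m n) t - char (m n) 0)"
      by (simp only: norm_mult)
    also have "\<dots> \<le> 1 * (d n * \<bar>t - 0\<bar>)"
      by (intro mult_mono A.cmod_char_le_1 B.char_lipschitz supp) auto
    finally show ?thesis by simp
  qed
  ultimately have "summable (\<lambda>n. ?f (Suc n) - ?f n)"
    by (rule summable_comparison_test'[where N=0])
  then have "convergent (\<lambda>n. ?f n - ?f 0)"
    unfolding summable_iff_convergent sum_lessThan_telescope[where f="?f"] .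
  then have "convergent (\<lambda>n. ?f n - ?f 0 + ?f 0)"
    by (intro convergent_add convergent_const)
  then show ?thesis by simp
qed

text \<open>Tightness yields a weak limit along a subsequence. As the characteristic functions
  converge along the whole sequence, Levy's continuity theorem extends the convergence to
  it.\<close>

lemma infinite_convolution_ex:
  "\<exists>\<mu>. real_distribution \<mu> \<and> weak_conv_m (finite_convolution m) \<mu>"
proof -
  have "0 \<le> D" using d_sum[of 0] by simp
  note fin = real_distribution_finite_convolution[of m, OF m]
  have "tight (finite_convolution m)"
    unfolding tight_def
  proof (intro conjI allI impI fin)
    fix \<epsilon> :: real assume "\<epsilon> > 0"
    \<comment> \<open>The left-open interval starts at -1 so that it contains a possible atom at 0
      and is nondegenerate even if \<open>D = 0\<close>.\<close>
    have "measure (finite_convolution m n) {-1<..D} = 1" for n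
    proof -
      interpret A: real_distribution "finite_convolution m n" by (rule fin)
      show ?thesis
        using finite_convolution_supp_D[of n] by (subst A.prob_eq_1) auto
    qed
    then show "\<exists>a b. a < b \<and> (\<forall>n. measure (finite_convolution m n) {a<..b} > 1 - \<epsilon>)"
      using \<open>\<epsilon> > 0\<close> \<open>0 \<le> D\<close> by (intro exI[of _ "-1"] exI[of _ D]) auto
  qed
  from tight_imp_convergent_subsubsequence[OF this strict_mono_id]
  obtain r \<mu> where r: "strict_mono (r :: nat \<Rightarrow> nat)" and \<mu>: "real_distribution \<mu>"
    "weak_conv_m (finite_convolution m \<circ> r) \<mu>"
    by (auto simp: id_def comp_def)
  have "(\<lambda>n. char (finite_convolution m n) t) \<longlonglongrightarrow> char \<mu> t" for t
  proof -
    obtain l where l: "(\<lambda>n. char (finite_convolution m n) t) \<longlonglongrightarrow> l"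
      using convergent_char by (auto simp: convergent_def)
    have "(\<lambda>n. char ((finite_convolution m \<circ> r) n) t) \<longlonglongrightarrow> char \<mu> t"
      by (rule levy_continuity1) (use \<mu> fin in \<open>auto simp: comp_def\<close>)
    moreover have "(\<lambda>n. char ((finite_convolution m \<circ> r) n) t) \<longlonglongrightarrow> l"
      using LIMSEQ_subseq_LIMSEQ[OF l r] by (simp add: comp_def)
    ultimately show ?thesis using l LIMSEQ_unique by blast
  qed
  then have "weak_conv_m (finite_convolution m) \<mu>" by (rule levy_continuity[OF fin \<mu>(1)])
  then show ?thesis using \<mu>(1) by blast
qed

lemma real_distribution_infinite_convolution: "real_distribution (infinite_convolution m)"
  and weak_conv_infinite_convolution: "weak_conv_m (finite_convolution m) (infinite_convolution m)"
  using infinite_convolution_ex infinite_convolution_eqI[of m] m by metis+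

lemma char_infinite_convolution:
  "(\<lambda>n. \<Prod>k<n. char (m k) t) \<longlonglongrightarrow> char (infinite_convolution m) t"
  unfolding char_finite_convolution[symmetric]
  by (intro levy_continuity1 real_distribution_finite_convolution m
      real_distribution_infinite_convolution weak_conv_infinite_convolution)

lemma infinite_convolution_supp: "AE x in infinite_convolution m. x \<in> {0..D}"
proof -
  interpret I: real_distribution "infinite_convolution m"
    by (rule real_distribution_infinite_convolution)
  \<comment> \<open>The distance to \<open>{0..D}\<close> truncated at 1: a bounded continuous test
    function that vanishes exactly on the interval.\<close>
  define f where "f x = min 1 (max 0 (max (- x) (x - D)))" for x :: real
  have f0: "f x = 0 \<longleftrightarrow> x \<in> {0..D}" for x by (auto simp: f_def)
  have f_le: "norm (f x) \<le> 1" and f_nonneg: "0 \<le> f x" for x by (auto simp: f_def)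
  have cont: "isCont f x" for x unfolding f_def by (intro continuous_intros)
  then have [measurable]: "f \<in> borel_measurable borel"
    by (intro borel_measurable_continuous_onI continuous_at_imp_continuous_on) auto
  have "(\<lambda>n. integral\<^sup>L (finite_convolution m n) f) \<longlonglongrightarrow> integral\<^sup>L (infinite_convolution m) f"
    by (rule weak_conv_imp_integral_bdd_continuous_conv[OF _ _ _ cont f_le])
      (auto intro: real_distribution_finite_convolution m I.real_distribution_axioms
        weak_conv_infinite_convolution)
  moreover have "integral\<^sup>L (finite_convolution m n) f = 0" for n
    by (rule integral_eq_zero_AE) (use finite_convolution_supp_D[of n] f0 in auto)
  ultimately have "integral\<^sup>L (infinite_convolution m) f = 0"
    by (simp add: LIMSEQ_const_iff)
  moreover have "integrable (infinite_convolution m) f"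
    by (rule I.integrable_const_bound[where B=1]) (use f_le in auto)
  ultimately have "AE x in infinite_convolution m. f x = 0"
    using f_nonneg by (subst (asm) integral_nonneg_eq_0_iff_AE) auto
  then show ?thesis using f0 by auto
qed

lemma infinite_convolution_lipschitz:
  "cmod (char (infinite_convolution m) s - char (infinite_convolution m) t) \<le> D * \<bar>s - t\<bar>"
  using real_distribution.char_lipschitz[OF real_distribution_infinite_convolution
      infinite_convolution_supp] .

end

section \<open>Fourier transforms of Cantor-Moran measures\<close>

lemma char_uniform_delta:
  assumes "finite A" "A \<noteq> {}"
  shows "char (uniform_delta A) t = (\<Sum>a\<in>A. iexp (t * a)) / of_nat (card A)"
proof -
  have "char (uniform_delta A) t = (\<integral>x. iexp (t * x) \<partial>measure_pmf (pmf_of_set A))"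
    by (simp add: char_def uniform_delta_def integral_distr)
  also have "\<dots> = (\<Sum>a\<in>A. pmf (pmf_of_set A) a *\<^sub>R iexp (t * a))"
    using assms by (intro integral_measure_pmf) auto
  also have "\<dots> = (\<Sum>a\<in>A. iexp (t * a)) / of_nat (card A)"
    using assms by (simp add: scaleR_conv_of_real sum_divide_distrib field_simps)
  finally show ?thesis .
qed

lemma AE_uniform_delta:
  assumes "finite A" "A \<noteq> {}" "\<And>a. a \<in> A \<Longrightarrow> P a" "{x. P x} \<in> sets borel"
  shows "AE x in uniform_delta A. P x"
  unfolding uniform_delta_def using assms
  by (subst AE_distr_iff) (auto simp: AE_measure_pmf_iff)

text \<open>Frequencies follow the sign convention of \<open>char\<close>, so \<open>digit_mask\<close>, \<open>tail_hat\<close>, \<open>partial_hat\<close> and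
  \<open>mu_hat\<close> are the complex conjugates of the usual Fourier transforms with kernel \<open>exp (- 2 \<pi> i \<xi> x)\<close>; only
  moduli and zeros matter.\<close>

definition digit_mask :: "int set \<Rightarrow> real \<Rightarrow> complex" where
  "digit_mask B x = (\<Sum>b\<in>B. fourier_exp x (of_int b)) / of_nat (card B)"

lemma digit_mask_periodic: "digit_mask B (x + of_int k) = digit_mask B x"
proof -
  have "fourier_exp (x + of_int k) (of_int b) = fourier_exp x (of_int b)" for b :: int
  proof -
    have "fourier_exp (of_int k) (of_int b) = cis (2 * pi * of_int (k * b))"
      by (simp add: fourier_exp_cis mult.assoc)
    also have "\<dots> = 1" by (rule cis_multiple_2pi) auto
    finally show ?thesis by (simp add: fourier_exp_add)
  qed
  then show ?thesis by (simp add: digit_mask_def)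
qed

lemma digit_mask_zero: "finite B \<Longrightarrow> B \<noteq> {} \<Longrightarrow> digit_mask B 0 = 1"
  by (simp add: digit_mask_def fourier_exp_def)

text \<open>Expanding the square turns the sum over \<open>L\<close> into inner products of rows of
  the Hadamard matrix, so only the \<open>card B\<close> diagonal pairs of digits survive.\<close>

lemma hadamard_triple_sum_digit_mask:
  assumes "hadamard_triple N B L"
  shows "(\<Sum>l\<in>L. (cmod (digit_mask B ((\<xi> + of_int l) / of_int N)))\<^sup>2) = 1"
proof -
  define M where "M = card B"
  have fin: "finite B" and ne: "B \<noteq> {}" and "N \<ge> 2"
    using assms by (auto simp: hadamard_triple_def)
  then have M: "M > 0" by (auto simp: M_def card_gt_0_iff)
  let ?E = "\<lambda>(b::int) (b'::int) x. cis (2 * pi * x * of_int b / of_int N) * cis (- (2 * pi * x * of_int b' / of_int N))"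
  have orth: "(\<Sum>l\<in>L. ?E b b' (real_of_int l)) = of_nat M * of_bool (b = b')"
    if "b \<in> B" "b' \<in> B" for b b'
  proof -
    define H where "H b l = 1 / complex_of_real (sqrt (real M)) *
      exp (- 2 * complex_of_real pi * \<i> * of_int b * of_int l / of_int N)" for b l :: int
    \<comment> \<open>The rows are taken in swapped order because \<open>H\<close> has a negative
      exponent while \<open>?E\<close> has a positive one in \<open>b\<close>.\<close>
    have "(\<Sum>l\<in>L. H b' l * cnj (H b l)) = of_bool (b' = b)"
      using assms that unfolding hadamard_triple_def unitary_on_def H_def M_def by blast
    moreover have "H b' l * cnj (H b l) = ?E b b' (real_of_int l) / of_nat M" for l
    proof -
      have H: "H c l = cis (- (2 * pi * of_int l * of_int c / of_int N)) / complex_of_real (sqrt (real M))" for c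
        by (simp add: H_def cis_conv_exp mult_ac)
      have "complex_of_real (sqrt (real M)) * complex_of_real (sqrt (real M)) = of_nat M"
        by (simp flip: of_real_mult)
      then show ?thesis by (simp add: H cis_cnj mult.commute)
    qed
    ultimately have "(\<Sum>l\<in>L. ?E b b' (real_of_int l) / of_nat M) = of_bool (b = b')" by auto
    then show ?thesis using M by (simp add: field_simps flip: sum_divide_distrib)
  qed
  have pt: "complex_of_real ((cmod (digit_mask B ((\<xi> + of_int l) / of_int N)))\<^sup>2) =
      (\<Sum>b\<in>B. \<Sum>b'\<in>B. ?E b b' \<xi> * ?E b b' (real_of_int l)) / (of_nat M)\<^sup>2" for l
  proof -
    have f: "fourier_exp ((\<xi> + of_int l) / of_int N) (of_int b) =
        cis (2 * pi * \<xi> * of_int b / of_int N) * cis (2 * pi * of_int l * of_int b / of_int N)" for b :: int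
      by (simp add: fourier_exp_cis cis_mult add_divide_distrib algebra_simps)
    show ?thesis
      unfolding complex_norm_square digit_mask_def f
      by (simp add: sum_product M_def power2_eq_square cis_cnj mult_ac)
  qed
  have "complex_of_real (\<Sum>l\<in>L. (cmod (digit_mask B ((\<xi> + of_int l) / of_int N)))\<^sup>2) =
      (\<Sum>l\<in>L. \<Sum>b\<in>B. \<Sum>b'\<in>B. ?E b b' \<xi> * ?E b b' (real_of_int l)) / (of_nat M)\<^sup>2"
    unfolding of_real_sum pt sum_divide_distrib[symmetric] ..
  also have "(\<Sum>l\<in>L. \<Sum>b\<in>B. \<Sum>b'\<in>B. ?E b b' \<xi> * ?E b b' (real_of_int l)) =
      (\<Sum>b\<in>B. \<Sum>l\<in>L. \<Sum>b'\<in>B. ?E b b' \<xi> * ?E b b' (real_of_int l))"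
    by (rule sum.swap)
  also have "\<dots> = (\<Sum>b\<in>B. \<Sum>b'\<in>B. \<Sum>l\<in>L. ?E b b' \<xi> * ?E b b' (real_of_int l))"
    by (rule sum.cong[OF refl], rule sum.swap)
  also have "\<dots> = (\<Sum>b\<in>B. \<Sum>b'\<in>B. if b = b' then of_nat M else 0)"
  proof (intro sum.cong refl)
    fix b b' assume b: "b \<in> B" "b' \<in> B"
    show "(\<Sum>l\<in>L. ?E b b' \<xi> * ?E b b' (real_of_int l)) = (if b = b' then of_nat M else 0)"
      unfolding sum_distrib_left[symmetric] orth[OF b] by (simp add: cis_mult)
  qed
  also have "\<dots> = (of_nat M)\<^sup>2"
    using fin by (simp add: M_def power2_eq_square)
  also have "(of_nat M)\<^sup>2 / (of_nat M)\<^sup>2 = complex_of_real 1" using M by simp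
  finally show ?thesis unfolding of_real_eq_iff .
qed

section \<open>Scales, factors and tails of a Moran sequence\<close>

locale moran =
  fixes N :: "nat \<Rightarrow> int" and B L :: "nat \<Rightarrow> int set"
  assumes hadamard: "\<And>n. n \<ge> 1 \<Longrightarrow> hadamard_triple (N n) (B n) (L n)"
    and digits: "\<And>n. n \<ge> 1 \<Longrightarrow> B n \<subseteq> {0 .. N n - 1}"
begin

definition P :: "nat \<Rightarrow> int" where "P n = (\<Prod>i=1..n. N i)"

lemma N_ge: "n \<ge> 1 \<Longrightarrow> N n \<ge> 2" and finite_B: "n \<ge> 1 \<Longrightarrow> finite (B n)"
  and B_nonempty: "n \<ge> 1 \<Longrightarrow> B n \<noteq> {}"
  using hadamard[of n] by (auto simp: hadamard_triple_def)

lemma P_0 [simp]: "P 0 = 1" by (simp add: P_def)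

lemma P_Suc: "P (Suc n) = P n * N (Suc n)" by (simp add: P_def)

lemma P_ge: "2 ^ n \<le> P n"
proof (induction n)
  case (Suc n)
  have "2 ^ n * 2 \<le> P n * N (Suc n)"
    using Suc N_ge[of "Suc n"] by (intro mult_mono) (auto intro: order_trans[OF _ Suc])
  then show ?case by (simp add: P_Suc)
qed simp

lemma P_pos: "0 < P n"
  using P_ge[of n] by (smt (verit) zero_less_power)

lemma filterlim_P: "filterlim (\<lambda>n. real_of_int (P n)) at_top sequentially"
proof (rule filterlim_at_top_mono)
  show "filterlim (\<lambda>n. 2 ^ n :: real) at_top sequentially" by real_asymp
  show "\<forall>\<^sub>F n in sequentially. 2 ^ n \<le> real_of_int (P n)"
    using P_ge by (intro always_eventually allI)
      (metis of_int_le_iff of_int_numeral of_int_power)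
qed

lemma real_distribution_moran_factor: "real_distribution (moran_factor N B n)"
  unfolding moran_factor_def by (rule real_distribution_uniform_delta)

lemma char_moran_factor:
  assumes "n \<ge> 1"
  shows "char (moran_factor N B n) (2 * pi * \<xi>) = digit_mask (B n) (\<xi> / of_int (P n))"
proof -
  have inj: "inj_on (\<lambda>b. 1 / real_of_int (P n) * real_of_int b) (B n)"
    using P_pos[of n] by (auto simp: inj_on_def)
  have "char (moran_factor N B n) (2 * pi * \<xi>) =
     (\<Sum>b\<in>B n. iexp (2 * pi * \<xi> * (1 / real_of_int (P n) * real_of_int b))) / of_nat (card (B n))"
    unfolding moran_factor_def P_def[symmetric] using finite_B B_nonempty assms inj
    by (subst char_uniform_delta) (auto simp: sum.reindex card_image)
  then show ?thesis by (simp add: digit_mask_def fourier_exp_iexp)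
qed

text \<open>The largest admissible digit is \<open>N (Suc n) - 1\<close>. Dividing it by
  \<open>P (Suc n)\<close> gives exactly this difference of reciprocals, so the lengths
  telescope.\<close>

lemma moran_factor_supp:
  "AE x in moran_factor N B (Suc n). x \<in> {0..1 / of_int (P n) - 1 / of_int (P (Suc n))}"
  unfolding moran_factor_def P_def[symmetric]
proof (rule AE_uniform_delta)
  fix a assume "a \<in> (\<lambda>b. 1 / real_of_int (P (Suc n)) * real_of_int b) ` B (Suc n)"
  then obtain b where b: "a = real_of_int b / real_of_int (P (Suc n))" "b \<in> B (Suc n)" by auto
  then have "0 \<le> b" "b \<le> N (Suc n) - 1" using digits[of "Suc n"] by auto
  moreover have "1 / of_int (P n) - 1 / of_int (P (Suc n)) = real_of_int (N (Suc n) - 1) / of_int (P (Suc n))"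
    using P_pos[of n] N_ge[of "Suc n"] by (simp add: P_Suc field_simps)
  ultimately show "a \<in> {0..1 / of_int (P n) - 1 / of_int (P (Suc n))}"
    using P_pos[of "Suc n"] by (auto simp: b intro!: divide_right_mono)
qed (use finite_B B_nonempty in auto)

lemma bounded_convolution_tail:
  "bounded_convolution (\<lambda>k. moran_factor N B (n + Suc k))
     (\<lambda>k. 1 / of_int (P (n + k)) - 1 / of_int (P (Suc (n + k)))) (1 / of_int (P n))"
proof (rule bounded_convolution.intro)
  have dec: "1 / real_of_int (P (Suc k)) \<le> 1 / real_of_int (P k)" for k
    using P_pos[of k] N_ge[of "Suc k"] by (simp add: P_Suc field_simps)
  show "0 \<le> 1 / real_of_int (P (n + k)) - 1 / real_of_int (P (Suc (n + k)))" for k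
    using dec by simp
  show "AE x in moran_factor N B (n + Suc k).
      x \<in> {0..1 / of_int (P (n + k)) - 1 / of_int (P (Suc (n + k)))}" for k
    unfolding add_Suc_right by (rule moran_factor_supp)
  have "(\<Sum>k<K. 1 / real_of_int (P (n + k)) - 1 / of_int (P (Suc (n + k)))) =
      1 / of_int (P n) - 1 / of_int (P (n + K))" for K
    using sum_lessThan_telescope'[of "\<lambda>k. 1 / real_of_int (P (n + k))" K] by simp
  then show "(\<Sum>k<K. 1 / real_of_int (P (n + k)) - 1 / of_int (P (Suc (n + k)))) \<le> 1 / of_int (P n)" for K
    using P_pos[of "n + K"] by simp
qed (rule real_distribution_moran_factor)

definition tail_hat :: "nat \<Rightarrow> real \<Rightarrow> complex" where
  "tail_hat n \<xi> = char (moran_tail_rescaled N B n) (2 * pi * \<xi>)"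

lemma real_distribution_moran_tail: "real_distribution (moran_tail N B n)"
  unfolding moran_tail_def
  by (rule bounded_convolution.real_distribution_infinite_convolution[OF bounded_convolution_tail])

lemma real_distribution_moran_tail_rescaled: "real_distribution (moran_tail_rescaled N B n)"
proof -
  interpret real_distribution "moran_tail N B n" by (rule real_distribution_moran_tail)
  show ?thesis unfolding moran_tail_rescaled_def by (rule real_distribution_distr) simp
qed

lemma tail_hat_eq: "tail_hat n \<xi> = char (moran_tail N B n) (2 * pi * (\<xi> * of_int (P n)))"
proof -
  interpret real_distribution "moran_tail N B n" by (rule real_distribution_moran_tail)
  show ?thesis
    unfolding tail_hat_def moran_tail_rescaled_def P_def[symmetric] char_def
    by (simp add: integral_distr mult_ac)
qed

lemma tail_hat_LIMSEQ:
  "(\<lambda>K. \<Prod>k<K. digit_mask (B (n + Suc k)) (\<xi> * of_int (P n) / of_int (P (n + Suc k)))) \<longlonglongrightarrow> tail_hat n \<xi>"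
proof -
  have "digit_mask (B (n + Suc k)) (\<xi> * of_int (P n) / of_int (P (n + Suc k))) =
      char (moran_factor N B (n + Suc k)) (2 * pi * (\<xi> * of_int (P n)))" for k
    by (rule char_moran_factor[symmetric]) simp
  then show ?thesis
    unfolding tail_hat_eq moran_tail_def
    by (simp only: bounded_convolution.char_infinite_convolution[OF bounded_convolution_tail])
qed

text \<open>The constant is independent of \<open>n\<close>: the tail lives on an interval of length
  \<open>1 / P n\<close>, and rescaling by \<open>P n\<close> stretches this to length 1.\<close>

lemma tail_hat_lipschitz: "cmod (tail_hat n s - tail_hat n t) \<le> 2 * pi * \<bar>s - t\<bar>"
proof -
  have "cmod (tail_hat n s - tail_hat n t) \<le>
      1 / of_int (P n) * \<bar>2 * pi * (s * of_int (P n)) - 2 * pi * (t * of_int (P n))\<bar>"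
    unfolding tail_hat_eq moran_tail_def
    by (rule bounded_convolution.infinite_convolution_lipschitz[OF bounded_convolution_tail])
  also have "2 * pi * (s * of_int (P n)) - 2 * pi * (t * of_int (P n)) = (2 * pi * of_int (P n)) * (s - t)"
    by (simp add: algebra_simps)
  also have "1 / of_int (P n) * \<bar>(2 * pi * of_int (P n)) * (s - t)\<bar> = 2 * pi * \<bar>s - t\<bar>"
    using P_pos[of n] by (simp add: abs_mult)
  finally show ?thesis .
qed

lemma tail_hat_0 [simp]: "tail_hat n 0 = 1"
  using real_distribution.char_zero[OF real_distribution_moran_tail_rescaled]
  by (simp add: tail_hat_def)

text \<open>The first factor of the infinite product splits off; dividing the frequency by
  \<open>N (Suc n)\<close> aligns the remaining ones with the next tail.\<close>

lemma tail_hat_Suc: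
  "tail_hat n \<xi> = digit_mask (B (Suc n)) (\<xi> / of_int (N (Suc n))) * tail_hat (Suc n) (\<xi> / of_int (N (Suc n)))"
proof -
  let ?a = "\<lambda>k. digit_mask (B (n + Suc k)) (\<xi> * of_int (P n) / of_int (P (n + Suc k)))"
  have N0: "N (Suc n) \<noteq> 0" and P0: "P n \<noteq> 0" using N_ge[of "Suc n"] P_pos[of n] by auto
  have "(\<lambda>K. ?a 0 * (\<Prod>k<K. ?a (Suc k))) \<longlonglongrightarrow> tail_hat n \<xi>"
    using LIMSEQ_Suc[OF tail_hat_LIMSEQ[of n \<xi>]] by (simp only: prod.lessThan_Suc_shift)
  moreover have "(\<lambda>K. ?a 0 * (\<Prod>k<K. ?a (Suc k))) \<longlonglongrightarrow> ?a 0 * tail_hat (Suc n) (\<xi> / of_int (N (Suc n)))"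
    using tail_hat_LIMSEQ[of "Suc n" "\<xi> / of_int (N (Suc n))"] N0
    by (intro tendsto_intros) (simp add: P_Suc)
  ultimately have "tail_hat n \<xi> = ?a 0 * tail_hat (Suc n) (\<xi> / of_int (N (Suc n)))"
    by (rule LIMSEQ_unique)
  then show ?thesis using P0 by (simp add: P_Suc)
qed

section \<open>Transforms of the measure and of its partial convolutions\<close>

definition mu_hat :: "real \<Rightarrow> complex" where
  "mu_hat \<xi> = char (cantor_moran N B) (2 * pi * \<xi>)"

definition partial_hat :: "nat \<Rightarrow> real \<Rightarrow> complex" where
  "partial_hat n \<xi> = (\<Prod>k<n. digit_mask (B (Suc k)) (\<xi> / of_int (P (Suc k))))"

lemma cantor_moran_eq_tail: "cantor_moran N B = moran_tail N B 0"
  by (simp add: cantor_moran_def moran_tail_def)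

lemma mu_hat_eq_tail_hat: "mu_hat \<xi> = tail_hat 0 \<xi>"
  by (simp add: mu_hat_def tail_hat_eq cantor_moran_eq_tail)

lemma partial_hat_Suc: "partial_hat (Suc n) \<xi> = partial_hat n \<xi> * digit_mask (B (Suc n)) (\<xi> / of_int (P (Suc n)))"
  by (simp add: partial_hat_def)

lemma partial_hat_LIMSEQ: "(\<lambda>n. partial_hat n \<xi>) \<longlonglongrightarrow> mu_hat \<xi>"
  using tail_hat_LIMSEQ[of 0 \<xi>] by (simp add: mu_hat_eq_tail_hat partial_hat_def)

lemma mu_hat_split: "mu_hat \<xi> = partial_hat n \<xi> * tail_hat n (\<xi> / of_int (P n))"
proof (induction n)
  case 0
  show ?case by (simp add: mu_hat_eq_tail_hat partial_hat_def)
next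
  case (Suc n)
  then show ?case
    using tail_hat_Suc[of n "\<xi> / of_int (P n)"] by (simp add: partial_hat_Suc P_Suc)
qed

lemma partial_hat_0 [simp]: "partial_hat n 0 = 1"
  by (simp add: partial_hat_def digit_mask_zero finite_B B_nonempty)

lemma partial_hat_periodic: "partial_hat n (\<xi> + of_int (P n * k)) = partial_hat n \<xi>"
proof (induction n arbitrary: k)
  case 0
  show ?case by (simp add: partial_hat_def)
next
  case (Suc n)
  have P0: "P (Suc n) \<noteq> 0" using P_pos[of "Suc n"] by auto
  \<comment> \<open>A multiple of \<open>P (Suc n)\<close> is a multiple of \<open>P n\<close> with
    the different cofactor \<open>N (Suc n) * k\<close>; hence the induction is over arbitrary
    \<open>k\<close>.\<close>
  have "partial_hat (Suc n) (\<xi> + of_int (P (Suc n) * k)) =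
      partial_hat n (\<xi> + of_int (P n * (N (Suc n) * k))) *
      digit_mask (B (Suc n)) (\<xi> / of_int (P (Suc n)) + of_int k)"
    using P0 by (simp add: partial_hat_Suc add_divide_distrib) (simp add: P_Suc mult.assoc)
  then show ?case by (simp only: Suc.IH digit_mask_periodic partial_hat_Suc)
qed

section \<open>Spectra of the partial convolutions\<close>

text \<open>The Jorgensen-Pedersen form of being a spectrum: Parseval's identity for all
  exponentials. It encodes completeness and, as shown next, orthogonality.\<close>

definition partial_spectrum :: "nat \<Rightarrow> int set \<Rightarrow> bool" where
  "partial_spectrum n \<Lambda> \<longleftrightarrow> finite \<Lambda> \<and>
     (\<forall>\<xi>. (\<Sum>l\<in>\<Lambda>. (cmod (partial_hat n (\<xi> + of_int l)))\<^sup>2) = 1)"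

text \<open>At \<open>\<xi> = - l'\<close> the term \<open>k = l'\<close> already accounts for the whole sum, so all other terms vanish.\<close>

lemma partial_spectrum_orthogonal:
  assumes "partial_spectrum n \<Lambda>" "l \<in> \<Lambda>" "l' \<in> \<Lambda>" "l \<noteq> l'"
  shows "partial_hat n (of_int (l - l')) = 0"
proof -
  have fin: "finite \<Lambda>" using assms(1) by (simp add: partial_spectrum_def)
  have "1 = (\<Sum>k\<in>\<Lambda>. (cmod (partial_hat n (- of_int l' + of_int k)))\<^sup>2)"
    using assms(1) unfolding partial_spectrum_def by (elim conjE allE[of _ "- of_int l'"]) (rule sym)
  also have "\<dots> = 1 + (\<Sum>k\<in>\<Lambda> - {l'}. (cmod (partial_hat n (- of_int l' + of_int k)))\<^sup>2)"
    using fin assms(3) by (subst sum.remove[of _ l']) auto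
  finally have "(\<Sum>k\<in>\<Lambda> - {l'}. (cmod (partial_hat n (- of_int l' + of_int k)))\<^sup>2) = 0" by simp
  then have "(cmod (partial_hat n (- of_int l' + of_int l)))\<^sup>2 = 0"
    using fin assms by (subst (asm) sum_nonneg_eq_0_iff) auto
  then show ?thesis by (simp add: algebra_simps)
qed

text \<open>Distinct frequencies are incongruent modulo \<open>P n\<close>: at their difference
  \<open>partial_hat n\<close> vanishes, whereas at a multiple of its period it equals 1.\<close>

lemma partial_spectrum_inj:
  assumes "partial_spectrum n \<Lambda>" "l \<in> \<Lambda>" "l' \<in> \<Lambda>" "l + P n * k = l' + P n * k'"
  shows "l = l'"
proof (rule ccontr)
  assume "l \<noteq> l'"
  then have "partial_hat n (of_int (l - l')) = 0"
    using partial_spectrum_orthogonal[OF assms(1-3)] by simp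
  moreover have "l - l' = P n * (k' - k)" using assms(4) by (simp add: algebra_simps)
  moreover have "partial_hat n (of_int (P n * (k' - k))) = 1"
    using partial_hat_periodic[of n 0 "k' - k"] by simp
  ultimately show False by simp
qed

lemma partial_spectrum_shift:
  assumes "partial_spectrum n \<Lambda>"
  shows "partial_spectrum n ((\<lambda>l. l + P n * k l) ` \<Lambda>)"
proof -
  have "inj_on (\<lambda>l. l + P n * k l) \<Lambda>"
    using partial_spectrum_inj[OF assms] by (meson inj_onI)
  then show ?thesis
    using assms partial_hat_periodic
    by (simp add: partial_spectrum_def sum.reindex flip: add.assoc of_int_mult)
qed

text \<open>By periodicity the translation leaves the first \<open>n\<close> factors alone, so the
  sum factors. The inner sum over \<open>L (Suc n)\<close> is 1 by the Hadamard identity, applied at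
  a point depending on \<open>l\<close>.\<close>

lemma partial_spectrum_Suc:
  assumes \<Lambda>: "partial_spectrum n \<Lambda>"
  shows "\<exists>\<Lambda>'. partial_spectrum (Suc n) \<Lambda>' \<and> \<Lambda> \<subseteq> \<Lambda>'"
proof -
  have h: "hadamard_triple (N (Suc n)) (B (Suc n)) (L (Suc n))" by (rule hadamard) simp
  then have "L (Suc n) \<noteq> {}" and finL: "finite (L (Suc n))"
    by (auto simp: hadamard_triple_def)
  then obtain l0 where l0: "l0 \<in> L (Suc n)" by blast
  \<comment> \<open>Translating \<open>L\<close> so that it contains \<open>0\<close> is what makes the new spectrum contain the old one.\<close>
  define s where "s = (\<lambda>(l, j). l + P n * (j - l0))"
  have inj: "inj_on s (\<Lambda> \<times> L (Suc n))"
  proof (rule inj_onI)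
    fix p q assume pq: "p \<in> \<Lambda> \<times> L (Suc n)" "q \<in> \<Lambda> \<times> L (Suc n)" "s p = s q"
    then have "fst p = fst q"
      using partial_spectrum_inj[OF \<Lambda>, of "fst p" "fst q" "snd p - l0" "snd q - l0"]
      by (auto simp: s_def case_prod_beta)
    then show "p = q" using pq(3) P_pos[of n] by (auto simp: s_def case_prod_beta prod_eq_iff)
  qed
  have "(\<Sum>l\<in>s ` (\<Lambda> \<times> L (Suc n)). (cmod (partial_hat (Suc n) (\<xi> + of_int l)))\<^sup>2) = 1" for \<xi>
  proof -
    have pt: "(cmod (partial_hat (Suc n) (\<xi> + of_int (s (l, j)))))\<^sup>2 =
        (cmod (partial_hat n (\<xi> + of_int l)))\<^sup>2 *
        (cmod (digit_mask (B (Suc n)) (((\<xi> + of_int l) / of_int (P n) - of_int l0 + of_int j) / of_int (N (Suc n)))))\<^sup>2"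
      for l j
    proof -
      have eq: "\<xi> + of_int (s (l, j)) = (\<xi> + of_int l) + of_int (P n * (j - l0))"
        by (simp add: s_def)
      have "partial_hat (Suc n) (\<xi> + of_int (s (l, j))) = partial_hat n (\<xi> + of_int l) *
          digit_mask (B (Suc n)) ((\<xi> + of_int (s (l, j))) / of_int (P (Suc n)))"
        unfolding partial_hat_Suc by (simp only: eq partial_hat_periodic)
      also have "(\<xi> + of_int (s (l, j))) / of_int (P (Suc n)) =
          ((\<xi> + of_int l) / of_int (P n) - of_int l0 + of_int j) / of_int (N (Suc n))"
        using P_pos[of n] N_ge[of "Suc n"] by (simp add: s_def P_Suc field_simps)
      finally show ?thesis by (simp add: norm_mult power_mult_distrib)
    qed
    have "(\<Sum>l\<in>s ` (\<Lambda> \<times> L (Suc n)). (cmod (partial_hat (Suc n) (\<xi> + of_int l)))\<^sup>2) =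
        (\<Sum>l\<in>\<Lambda>. \<Sum>j\<in>L (Suc n). (cmod (partial_hat (Suc n) (\<xi> + of_int (s (l, j)))))\<^sup>2)"
      by (subst sum.reindex[OF inj]) (simp add: sum.cartesian_product)
    also have "\<dots> = (\<Sum>l\<in>\<Lambda>. (cmod (partial_hat n (\<xi> + of_int l)))\<^sup>2)"
      unfolding pt sum_distrib_left[symmetric] hadamard_triple_sum_digit_mask[OF h] by simp
    also have "\<dots> = 1" using \<Lambda> by (simp add: partial_spectrum_def)
    finally show ?thesis .
  qed
  then have "partial_spectrum (Suc n) (s ` (\<Lambda> \<times> L (Suc n)))"
    using \<Lambda> finL by (simp add: partial_spectrum_def)
  moreover have "\<Lambda> \<subseteq> s ` (\<Lambda> \<times> L (Suc n))"
    using l0 by (force simp: s_def)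
  ultimately show ?thesis by blast
qed

lemma partial_spectrum_le:
  assumes "n \<le> m" "partial_spectrum n \<Lambda>"
  shows "\<exists>\<Lambda>'. partial_spectrum m \<Lambda>' \<and> \<Lambda> \<subseteq> \<Lambda>'"
  using assms(1)
proof (induction m rule: dec_induct)
  case base
  then show ?case using assms(2) by blast
next
  case (step m)
  then show ?case using partial_spectrum_Suc by (meson order_trans)
qed

lemma norm_tail_hat_ge:
  assumes "\<bar>x\<bar> \<le> 1 / (4 * pi)"
  shows "1 / 2 \<le> cmod (tail_hat n x)"
proof -
  have "cmod (tail_hat n 0 - tail_hat n x) \<le> 2 * pi * \<bar>x\<bar>"
    using tail_hat_lipschitz[of n 0 x] by simp
  also have "\<dots> \<le> 1 / 2" using assms by (simp add: field_simps)
  finally show ?thesis using norm_triangle_ineq2[of 1 "1 - tail_hat n x"] by simp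
qed

text \<open>Frequencies may be moved by multiples of \<open>P m\<close>, since \<open>partial_hat m\<close> has period \<open>P m\<close>. Those inherited
  from \<open>\<Lambda>\<close> stay in place: for large \<open>m\<close> they are tiny after division by \<open>P m\<close>.\<close>

lemma partial_spectrum_extend:
  assumes \<epsilon>: "\<epsilon> \<le> 1 / 2"
    and inf: "\<exists>\<^sub>F n in sequentially. \<forall>x. \<exists>k::int. \<epsilon> \<le> cmod (tail_hat n (x + of_int k))"
    and \<Lambda>: "partial_spectrum n \<Lambda>"
  shows "\<exists>m \<Lambda>'. n < m \<and> partial_spectrum m \<Lambda>' \<and> \<Lambda> \<subseteq> \<Lambda>' \<and>
    (\<forall>l\<in>\<Lambda>'. \<epsilon> \<le> cmod (tail_hat m (of_int l / of_int (P m))))"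
proof -
  have fin: "finite \<Lambda>" using \<Lambda> by (simp add: partial_spectrum_def)
  have "\<forall>\<^sub>F m in sequentially. \<bar>real_of_int l / of_int (P m)\<bar> \<le> 1 / (4 * pi)" for l
  proof -
    have "\<forall>\<^sub>F m in sequentially. 4 * pi * \<bar>real_of_int l\<bar> \<le> of_int (P m)"
      using filterlim_P by (simp add: filterlim_at_top)
    then show ?thesis
    proof eventually_elim
      case (elim m)
      then show ?case using P_pos[of m] by (simp add: field_simps)
    qed
  qed
  then have "\<forall>\<^sub>F m in sequentially. \<forall>l\<in>\<Lambda>. \<bar>real_of_int l / of_int (P m)\<bar> \<le> 1 / (4 * pi)"
    using fin by (simp add: eventually_ball_finite)
  then have "\<forall>\<^sub>F m in sequentially. n < m \<and> (\<forall>l\<in>\<Lambda>. \<bar>real_of_int l / of_int (P m)\<bar> \<le> 1 / (4 * pi))"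
    using eventually_gt_at_top[of n] by eventually_elim simp
  from frequently_ex[OF frequently_eventually_frequently[OF inf this]] obtain m where m:
    "\<And>x. \<exists>k::int. \<epsilon> \<le> cmod (tail_hat m (x + of_int k))" "n < m"
    "\<And>l. l \<in> \<Lambda> \<Longrightarrow> \<bar>real_of_int l / of_int (P m)\<bar> \<le> 1 / (4 * pi)"
    by blast
  \<comment> \<open>Frequencies tiny on the scale \<open>P m\<close> get translation 0, which keeps
    those of \<open>\<Lambda>\<close> fixed. The tail is at least 1/2 there, so
    \<open>\<epsilon> \<le> 1 / 2\<close> makes the bound uniform.\<close>
  define k :: "int \<Rightarrow> int" where "k l = (if \<bar>real_of_int l / of_int (P m)\<bar> \<le> 1 / (4 * pi) then 0
    else SOME k. \<epsilon> \<le> cmod (tail_hat m (of_int l / of_int (P m) + of_int k)))" for l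
  have k: "\<epsilon> \<le> cmod (tail_hat m (of_int l / of_int (P m) + of_int (k l)))" for l
    using norm_tail_hat_ge[of "of_int l / of_int (P m)" m] \<epsilon> someI_ex[OF m(1)[of "of_int l / of_int (P m)"]]
    by (auto simp: k_def)
  obtain \<Lambda>1 where \<Lambda>1: "partial_spectrum m \<Lambda>1" "\<Lambda> \<subseteq> \<Lambda>1"
    using partial_spectrum_le[OF _ \<Lambda>, of m] m(2) by auto
  let ?\<Lambda> = "(\<lambda>l. l + P m * k l) ` \<Lambda>1"
  have "l \<in> ?\<Lambda>" if "l \<in> \<Lambda>" for l
    using that \<Lambda>1(2) m(3)[OF that] by (intro image_eqI[of _ _ l]) (auto simp: k_def)
  moreover have "\<epsilon> \<le> cmod (tail_hat m (of_int l / of_int (P m)))" if l: "l \<in> ?\<Lambda>" for l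
  proof -
    obtain l1 where "l = l1 + P m * k l1" using l by blast
    then have "of_int l / of_int (P m) = real_of_int l1 / of_int (P m) + of_int (k l1)"
      using P_pos[of m] by (simp add: field_simps)
    then show ?thesis using k[of l1] by simp
  qed
  ultimately show ?thesis
    using m(2) partial_spectrum_shift[OF \<Lambda>1(1), of k] by blast
qed

section \<open>From partial spectra to a spectrum of the full measure\<close>

lemma partial_spectrum_zero: "partial_spectrum 0 {0}"
  by (simp add: partial_spectrum_def partial_hat_def)

theorem spectral_measure_cantor_moran:
  assumes \<epsilon>: "0 < \<epsilon>"
    and inf: "\<exists>\<^sub>F n in sequentially. \<forall>x. \<exists>k::int. \<epsilon> \<le> cmod (tail_hat n (x + of_int k))"
  shows "spectral_measure (cantor_moran N B)"
proof -
  define e where "e = min \<epsilon> (1 / 2)"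
  have e: "0 < e" "e \<le> 1 / 2" using \<epsilon> by (auto simp: e_def)
  have inf_e: "\<exists>\<^sub>F n in sequentially. \<forall>x. \<exists>k::int. e \<le> cmod (tail_hat n (x + of_int k))"
    using inf by (rule frequently_elim1) (auto simp: e_def min_le_iff_disj)
  define good where "good s \<longleftrightarrow> partial_spectrum (fst s) (snd s) \<and>
    (\<forall>l\<in>snd s. e \<le> cmod (tail_hat (fst s) (of_int l / of_int (P (fst s)))))" for s
  define R where "R s t \<longleftrightarrow> fst s < fst t \<and> snd s \<subseteq> snd t" for s t :: "nat \<times> int set"
  have "\<exists>f. \<forall>j::nat. good (f j) \<and> R (f j) (f (Suc j))"
  proof (rule dependent_nat_choice)
    show "\<exists>s. good s"
      using partial_spectrum_zero e by (intro exI[of _ "(0, {0})"]) (simp add: good_def)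
    show "\<exists>t. good t \<and> R s t" if "good s" for s j
      using partial_spectrum_extend[OF e(2) inf_e, of "fst s" "snd s"] that
      by (auto simp: good_def R_def)
  qed
  then obtain f where f: "\<And>j::nat. good (f j)" "\<And>j. R (f j) (f (Suc j))" by blast
  define n where "n j = fst (f j)" for j
  define \<Lambda> where "\<Lambda> j = snd (f j)" for j
  have spec: "partial_spectrum (n j) (\<Lambda> j)" and
    tail: "l \<in> \<Lambda> j \<Longrightarrow> e \<le> cmod (tail_hat (n j) (of_int l / of_int (P (n j))))" for j l
    using f(1)[of j] by (auto simp: good_def n_def \<Lambda>_def)
  have n_mono: "strict_mono n" using f(2) by (simp add: strict_mono_Suc_iff n_def R_def)
  have \<Lambda>_mono: "mono \<Lambda>" using f(2) by (simp add: mono_iff_le_Suc \<Lambda>_def R_def)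
  have fin: "finite (\<Lambda> j)" for j using spec by (simp add: partial_spectrum_def)
  define S where "S = (\<Union>j. \<Lambda> j)"
  have sub: "\<exists>j. F \<subseteq> \<Lambda> j" if "finite F" "F \<subseteq> S" for F
    using that
  proof (induction F rule: finite_induct)
    case (insert x F)
    then obtain i j where "F \<subseteq> \<Lambda> i" "x \<in> \<Lambda> j" by (auto simp: S_def)
    then have "insert x F \<subseteq> \<Lambda> (max i j)"
      using monoD[OF \<Lambda>_mono, of i "max i j"] monoD[OF \<Lambda>_mono, of j "max i j"] by auto
    then show ?case by blast
  qed simp
  have partial_lim: "(\<lambda>j. partial_hat (n j) \<xi>) \<longlonglongrightarrow> mu_hat \<xi>" for \<xi>
    using LIMSEQ_subseq_LIMSEQ[OF partial_hat_LIMSEQ n_mono] by (simp add: comp_def)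
  interpret M: real_distribution "cantor_moran N B"
    unfolding cantor_moran_eq_tail by (rule real_distribution_moran_tail)
  show ?thesis
  proof (rule M.spectral_measureI)
    show "AE x in cantor_moran N B. x \<in> {0..1}"
      using bounded_convolution.infinite_convolution_supp[OF bounded_convolution_tail, of 0]
      unfolding cantor_moran_eq_tail moran_tail_def P_0 of_int_1 div_by_1 .
    show "countable (real_of_int ` S)" by simp
    show "char (cantor_moran N B) (2 * pi * (l - l')) = 0"
      if "l \<in> real_of_int ` S" "l' \<in> real_of_int ` S" "l \<noteq> l'" for l l'
    proof -
      obtain i i' where i: "l = of_int i" "l' = of_int i'" "i \<in> S" "i' \<in> S" "i \<noteq> i'"
        using \<open>l \<in> _\<close> \<open>l' \<in> _\<close> \<open>l \<noteq> l'\<close> by auto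
      then obtain j where "{i, i'} \<subseteq> \<Lambda> j" using sub[of "{i, i'}"] by auto
      then have "partial_hat (n j) (of_int (i - i')) = 0"
        using partial_spectrum_orthogonal[OF spec[of j]] i(5) by auto
      then show ?thesis
        using mu_hat_split[of "of_int (i - i')" "n j"] i by (simp add: mu_hat_def)
    qed
    fix \<xi> \<epsilon>' :: real assume "\<epsilon>' > 0"
    \<comment> \<open>\<open>partial_spectrum\<close> adds frequencies while
      \<open>spectral_measureI\<close> subtracts them; the sign of \<open>\<xi>\<close> is flipped
      because characteristic functions have even modulus.\<close>
    define h where "h l = (cmod (mu_hat (- \<xi> + of_int l)))\<^sup>2" for l
    define p where "p j l = (cmod (partial_hat (n j) (- \<xi> + of_int l)))\<^sup>2" for j l
    have p_sum: "(\<Sum>l\<in>\<Lambda> j. p j l) = 1" for j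
      using spec[of j] unfolding partial_spectrum_def p_def by blast
    have h_nonneg: "0 \<le> h l" and p_nonneg: "0 \<le> p j l" for l j by (auto simp: h_def p_def)
    have p_lim: "(\<lambda>j. p j l) \<longlonglongrightarrow> h l" for l
      unfolding p_def h_def by (intro tendsto_intros partial_lim)
    have h_split: "h l = p j l * (cmod (tail_hat (n j) ((- \<xi> + of_int l) / of_int (P (n j)))))\<^sup>2" for l j
      unfolding h_def p_def mu_hat_split[of "- \<xi> + of_int l" "n j"]
      by (simp add: norm_mult power_mult_distrib)
    have tail_le: "cmod (tail_hat m x) \<le> 1" for m x
      unfolding tail_hat_def
      by (rule real_distribution.cmod_char_le_1[OF real_distribution_moran_tail_rescaled])
    have h_le: "h l \<le> p j l" for l j
      unfolding h_split[of l j] using tail_le p_nonneg by (intro mult_left_le power_le_one) auto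
    have h_sum_le: "(\<Sum>l\<in>F. h l) \<le> 1" if "finite F" "F \<subseteq> S" for F
    proof -
      obtain j where j: "F \<subseteq> \<Lambda> j" using sub \<open>finite F\<close> \<open>F \<subseteq> S\<close> by blast
      have "(\<Sum>l\<in>F. h l) \<le> (\<Sum>l\<in>\<Lambda> j. h l)" by (intro sum_mono2 fin j h_nonneg)
      also have "\<dots> \<le> (\<Sum>l\<in>\<Lambda> j. p j l)" by (intro sum_mono h_le)
      finally show ?thesis by (simp add: p_sum)
    qed
    \<comment> \<open>Chosen so that the domination constant \<open>4 / e\<^sup>2\<close> times
      \<open>\<delta>\<close> is \<open>\<epsilon>' / 4\<close>.\<close>
    define \<delta> where "\<delta> = \<epsilon>' * e\<^sup>2 / 16"
    have "\<delta> > 0" using \<open>\<epsilon>' > 0\<close> e by (simp add: \<delta>_def)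
    let ?X = "(\<lambda>F. \<Sum>l\<in>F. h l) ` {F. finite F \<and> F \<subseteq> S}"
    have bdd: "bdd_above ?X" using h_sum_le by (intro bdd_aboveI[of _ 1]) auto
    \<comment> \<open>The finite sums of \<open>h\<close> are bounded, so some finite
      \<open>F\<close> captures all but \<open>\<delta>\<close> of their supremum. Any finite set
      disjoint from \<open>F\<close> then carries mass at most \<open>\<delta>\<close>.\<close>
    have "\<exists>x\<in>?X. Sup ?X - \<delta> < x"
      using \<open>\<delta> > 0\<close> by (subst less_cSup_iff[symmetric, OF _ bdd]) auto
    then obtain F where F: "finite F" "F \<subseteq> S" "Sup ?X - \<delta> < (\<Sum>l\<in>F. h l)" by auto
    have rest: "(\<Sum>l\<in>G. h l) \<le> \<delta>" if G: "finite G" "G \<subseteq> S" "G \<inter> F = {}" for G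
    proof -
      have "(\<Sum>l\<in>F \<union> G. h l) \<le> Sup ?X" using F G by (intro cSup_upper bdd) auto
      moreover have "(\<Sum>l\<in>F \<union> G. h l) = (\<Sum>l\<in>F. h l) + (\<Sum>l\<in>G. h l)"
        using F G by (intro sum.union_disjoint) auto
      ultimately show ?thesis using F(3) by linarith
    qed
    obtain J where J: "F \<subseteq> \<Lambda> J" using sub F by blast
    have "\<forall>\<^sub>F j in sequentially. 4 * pi * \<bar>\<xi>\<bar> / e \<le> of_int (P (n j))"
      using filterlim_compose[OF filterlim_P filterlim_subseq[OF n_mono]]
      by (simp add: filterlim_at_top)
    then have "\<forall>\<^sub>F j in sequentially. 1 - \<epsilon>' / 4 \<le> (\<Sum>l\<in>F. p j l)"
      using eventually_ge_at_top[of J]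
    proof eventually_elim
      case (elim j)
      have Fj: "F \<subseteq> \<Lambda> j" using J monoD[OF \<Lambda>_mono elim(2)] by blast
      have pos: "0 < real_of_int (P (n j))" using P_pos by simp
      \<comment> \<open>The tail factor is at least \<open>e\<close> at \<open>l / P (n j)\<close>.
        The shift by \<open>\<xi> / P (n j)\<close> costs at most \<open>e / 2\<close> by the
        Lipschitz bound, as \<open>P (n j)\<close> is large.\<close>
      have "p j l \<le> 4 / e\<^sup>2 * h l" if l: "l \<in> \<Lambda> j" for l
      proof -
        have "cmod (tail_hat (n j) (of_int l / of_int (P (n j))) - tail_hat (n j) ((- \<xi> + of_int l) / of_int (P (n j))))
            \<le> 2 * pi * \<bar>of_int l / of_int (P (n j)) - (- \<xi> + of_int l) / of_int (P (n j))\<bar>"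
          by (rule tail_hat_lipschitz)
        also have "\<dots> = 2 * pi * \<bar>\<xi>\<bar> / of_int (P (n j))"
          using pos by (simp add: abs_divide flip: diff_divide_distrib)
        also have "\<dots> \<le> e / 2" using elim(1) pos e by (simp add: field_simps)
        finally have "e / 2 \<le> cmod (tail_hat (n j) ((- \<xi> + of_int l) / of_int (P (n j))))"
          using tail[OF l] norm_triangle_ineq2[of "tail_hat (n j) (of_int l / of_int (P (n j)))"
              "tail_hat (n j) ((- \<xi> + of_int l) / of_int (P (n j)))"] by linarith
        then have "(e / 2)\<^sup>2 \<le> (cmod (tail_hat (n j) ((- \<xi> + of_int l) / of_int (P (n j)))))\<^sup>2"
          using e by (intro power_mono) auto
        then have "p j l * (e / 2)\<^sup>2 \<le> h l"
          unfolding h_split[of l j] by (intro mult_left_mono p_nonneg)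
        then show ?thesis using e by (simp add: field_simps power2_eq_square)
      qed
      then have "(\<Sum>l\<in>\<Lambda> j - F. p j l) \<le> (\<Sum>l\<in>\<Lambda> j - F. 4 / e\<^sup>2 * h l)"
        by (intro sum_mono) auto
      also have "\<dots> \<le> 4 / e\<^sup>2 * \<delta>"
        unfolding sum_distrib_left[symmetric]
        by (intro mult_left_mono rest) (use fin in \<open>auto simp: S_def\<close>)
      also have "\<dots> = \<epsilon>' / 4" using e by (simp add: \<delta>_def)
      finally show ?case
        using p_sum[of j] sum.subset_diff[OF Fj fin, of "p j"] by linarith
    qed
    moreover have "(\<lambda>j. \<Sum>l\<in>F. p j l) \<longlonglongrightarrow> (\<Sum>l\<in>F. h l)" by (intro tendsto_sum p_lim)
    \<comment> \<open>\<open>F\<close> does not depend on \<open>j\<close>, so the bound on the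
      finite sum passes to the limit.\<close>
    ultimately have "1 - \<epsilon>' / 4 \<le> (\<Sum>l\<in>F. h l)"
      by (intro tendsto_lowerbound) auto
    moreover have "(\<Sum>l\<in>real_of_int ` F. (cmod (char (cantor_moran N B) (2 * pi * (\<xi> - l))))\<^sup>2) = (\<Sum>l\<in>F. h l)"
    proof -
      have "cmod (char (cantor_moran N B) (2 * pi * (\<xi> - real_of_int l))) = cmod (mu_hat (- \<xi> + of_int l))" for l
        using char_uminus[of "cantor_moran N B" "2 * pi * (- \<xi> + of_int l)"]
        by (simp add: mu_hat_def algebra_simps)
      then show ?thesis by (subst sum.reindex) (simp_all add: h_def inj_on_def)
    qed
    ultimately show "\<exists>F. finite F \<and> F \<subseteq> real_of_int ` S \<and>
        1 - \<epsilon>' < (\<Sum>l\<in>F. (cmod (char (cantor_moran N B) (2 * pi * (\<xi> - l))))\<^sup>2)"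
      using F(1,2) \<open>\<epsilon>' > 0\<close> by (intro exI[of _ "real_of_int ` F"]) auto
  qed
qed

end

section \<open>Lower bounds for the tails\<close>

lemma abs_sin_diff_le: "\<bar>sin x - sin y\<bar> \<le> \<bar>x - y\<bar>" for x y :: real
proof -
  have "\<bar>sin x - sin y\<bar> = \<bar>Im (iexp x - iexp y)\<bar>" by (simp add: Im_exp)
  also have "\<dots> \<le> \<bar>x - y\<bar>"
    using abs_Im_le_cmod norm_iexp_diff_le by (rule order_trans)
  finally show ?thesis .
qed

text \<open>If \<open>N x\<close> is a half-integer, \<open>sin (2 \<pi> b x)\<close> is invariant under \<open>b \<mapsto> N - b\<close>, so the imaginary parts
  from the two ends of the digit set add up.\<close>

lemma norm_digit_mask_reflected_ge:
  fixes N :: int and B0 :: "int set" and t \<delta> :: real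
  assumes N: "N > 0" and fin: "finite B0"
    and B0: "\<And>b. b \<in> B0 \<Longrightarrow> 0 \<le> b \<and> of_int b \<le> of_int N * \<delta>"
    and disj: "B0 \<inter> (\<lambda>b. N - b) ` (B0 - {0}) = {}"
    and k: "\<bar>1 / 2 + of_int k - of_int N * t\<bar> \<le> 1 / 2"
  defines "B \<equiv> B0 \<union> (\<lambda>b. N - b) ` (B0 - {0})"
  shows "2 * (\<bar>\<Sum>b\<in>B0. sin (2 * pi * of_int b * t)\<bar> - pi * \<delta> * card B0)
    \<le> card B * cmod (digit_mask B ((1 / 2 + of_int k) / of_int N))"
proof (cases "B0 = {}")
  case True
  then show ?thesis by (simp add: B_def)
next
  case False
  define x where "x = (1 / 2 + real_of_int k) / of_int N"
  have xN: "of_int N * x = 1 / 2 + of_int k" using N by (simp add: x_def)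
  let ?s = "\<lambda>b::int. sin (2 * pi * x * of_int b)"
  have refl: "?s (N - b) = ?s b" for b
  proof -
    have "2 * pi * x * of_int (N - b) = (pi - 2 * pi * x * of_int b) + 2 * pi * of_int k"
      using arg_cong[OF xN, of "\<lambda>y. 2 * pi * y"] by (simp add: algebra_simps)
    then have "?s (N - b) = sin (pi - 2 * pi * x * of_int b)"
      by (simp only: sin_add sin_int_2pin cos_int_2pin mult_zero_right mult_1_right add_0_right)
    then show ?thesis by simp
  qed
  have finB: "finite B" using fin by (simp add: B_def)
  have "B \<noteq> {}" using False by (simp add: B_def)
  have "Im (\<Sum>b\<in>B. fourier_exp x (of_int b)) = (\<Sum>b\<in>B. ?s b)"
    by (simp add: fourier_exp_cis)
  also have "\<dots> = (\<Sum>b\<in>B0. ?s b) + (\<Sum>b\<in>(\<lambda>b. N - b) ` (B0 - {0}). ?s b)"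
    unfolding B_def using fin disj by (intro sum.union_disjoint) auto
  also have "(\<Sum>b\<in>(\<lambda>b. N - b) ` (B0 - {0}). ?s b) = (\<Sum>b\<in>B0 - {0}. ?s b)"
    using refl by (subst sum.reindex) (auto simp: inj_on_def)
  \<comment> \<open>The digit 0 has no reflection in \<open>B\<close>, but its sine vanishes, so it
    may be restored to the sum.\<close>
  also have "\<dots> = (\<Sum>b\<in>B0. ?s b)"
    using fin by (intro sum.mono_neutral_left) auto
  finally have Im_eq: "Im (\<Sum>b\<in>B. fourier_exp x (of_int b)) = 2 * (\<Sum>b\<in>B0. ?s b)" by simp
  \<comment> \<open>Replacing \<open>t\<close> by \<open>x\<close> is cheap:
    \<open>of_int N * x\<close> and \<open>of_int N * t\<close> differ by at most 1/2 and
    \<open>b / N\<close> is at most \<open>\<delta>\<close>, so each term changes by at most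
    \<open>pi * \<delta>\<close>.\<close>
  have "\<bar>(\<Sum>b\<in>B0. sin (2 * pi * of_int b * t)) - (\<Sum>b\<in>B0. ?s b)\<bar>
      \<le> (\<Sum>b\<in>B0. \<bar>sin (2 * pi * of_int b * t) - ?s b\<bar>)"
    unfolding sum_subtractf[symmetric] by (rule sum_abs)
  also have "\<dots> \<le> (\<Sum>b\<in>B0. pi * \<delta>)"
  proof (rule sum_mono)
    fix b assume b: "b \<in> B0"
    have "\<bar>sin (2 * pi * of_int b * t) - ?s b\<bar> \<le> \<bar>2 * pi * of_int b * t - 2 * pi * x * of_int b\<bar>"
      by (rule abs_sin_diff_le)
    also have "2 * pi * of_int b * t - 2 * pi * x * of_int b = (2 * pi * of_int b / of_int N) * (of_int N * t - of_int N * x)"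
      using N by (simp add: field_simps)
    also have "\<bar>\<dots>\<bar> = (2 * pi * of_int b / of_int N) * \<bar>1 / 2 + of_int k - of_int N * t\<bar>"
      using N B0[OF b] by (simp add: xN abs_mult abs_divide abs_minus_commute)
    also have "\<dots> \<le> (2 * pi * of_int b / of_int N) * (1 / 2)"
      using N B0[OF b] k by (intro mult_left_mono) auto
    also have "\<dots> \<le> pi * \<delta>" using N B0[OF b] by (simp add: field_simps)
    finally show "\<bar>sin (2 * pi * of_int b * t) - ?s b\<bar> \<le> pi * \<delta>" .
  qed
  finally have "\<bar>\<Sum>b\<in>B0. sin (2 * pi * of_int b * t)\<bar> - pi * \<delta> * card B0 \<le> \<bar>\<Sum>b\<in>B0. ?s b\<bar>"
    by (simp add: mult_ac)
  also have "2 * \<bar>\<Sum>b\<in>B0. ?s b\<bar> \<le> cmod (\<Sum>b\<in>B. fourier_exp x (of_int b))"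
    using abs_Im_le_cmod[of "\<Sum>b\<in>B. fourier_exp x (of_int b)"] unfolding Im_eq by (simp add: abs_mult)
  also have "\<dots> = card B * cmod (digit_mask B x)"
    using finB \<open>B \<noteq> {}\<close> by (simp add: digit_mask_def norm_divide)
  finally show ?thesis by (simp add: x_def)
qed

text \<open>Reconciles the fixed \<open>\<delta>\<close> of the sine problem with the smaller
  \<open>\<delta>'\<close> from symmetry. No digit lies strictly between the two ends, so both
  cutoffs select the same digits near zero.\<close>

lemma near_zero_reflected:
  fixes N :: int and B :: "int set" and \<delta> \<delta>' :: real
  assumes N: "N > 0" and digits: "B \<subseteq> {0..N - 1}"
    and \<delta>: "\<delta>' \<le> \<delta>" "\<delta> < 1 / 3"
    and ends: "B = near_ends N B \<delta>'"
    and symm: "near_one N B \<delta>' = near_zero N B \<delta>' - {0}"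
  defines "B0 \<equiv> near_zero N B \<delta>"
  shows "\<And>b. b \<in> B0 \<Longrightarrow> 0 \<le> b \<and> of_int b \<le> of_int N * \<delta>'"
    and "B = B0 \<union> (\<lambda>b. N - b) ` (B0 - {0})"
    and "B0 \<inter> (\<lambda>b. N - b) ` (B0 - {0}) = {}"
proof -
  have dich: "of_int b \<le> of_int N * \<delta>' \<or> of_int N * (1 - \<delta>') \<le> of_int b" if "b \<in> B" for b
  proof -
    have "b \<in> near_ends N B \<delta>'" using that ends by simp
    then show ?thesis using N by (auto simp: near_ends_def field_simps not_less)
  qed
  have less: "of_int N * \<delta> < of_int N * (1 - \<delta>')" using N \<delta> by simp
  have le: "of_int N * \<delta>' \<le> of_int N * \<delta>" using N \<delta> by simp
  have B0_eq: "B0 = {b \<in> B. of_int b \<le> of_int N * \<delta>'}"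
  proof -
    have "of_int b / of_int N \<le> \<delta>" if "of_int b \<le> of_int N * \<delta>'" for b :: int
    proof -
      have "of_int b \<le> of_int N * \<delta>" using that le by linarith
      then show ?thesis using N by (simp add: pos_divide_le_eq mult.commute)
    qed
    note le_div = this
    show ?thesis
    proof (intro set_eqI iffI)
      fix b assume "b \<in> B0"
      then have b: "b \<in> B" "of_int b \<le> of_int N * \<delta>" by (auto simp: B0_def near_zero_def near_ends_def)
      then show "b \<in> {b \<in> B. of_int b \<le> of_int N * \<delta>'}" using dich[OF b(1)] less by auto
    next
      fix b assume "b \<in> {b \<in> B. of_int b \<le> of_int N * \<delta>'}"
      then have b: "b \<in> B" "of_int b \<le> of_int N * \<delta>'" by auto
      then have "0 \<le> b" using digits by auto
      then show "b \<in> B0" using b le le_div[OF b(2)] by (simp add: B0_def near_zero_def near_ends_def)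
    qed
  qed
  then show "0 \<le> b \<and> of_int b \<le> of_int N * \<delta>'" if "b \<in> B0" for b
    using that digits by auto
  have zero_eq: "near_zero N B \<delta>' = B0"
    unfolding near_zero_def ends[symmetric] B0_eq using digits by auto
  have "near_one N B \<delta>' = (\<lambda>b. N - b) ` {b \<in> B. of_int N * (1 - \<delta>') \<le> of_int b}"
    unfolding near_one_def ends[symmetric] using digits
    by (intro arg_cong[where f="\<lambda>S. (\<lambda>b. N - b) ` S"]) auto
  then have "(\<lambda>b. N - b) ` (B0 - {0}) = (\<lambda>b. N - b) ` (\<lambda>b. N - b) ` {b \<in> B. of_int N * (1 - \<delta>') \<le> of_int b}"
    using symm zero_eq by simp
  also have "\<dots> = {b \<in> B. of_int N * (1 - \<delta>') \<le> of_int b}" by (simp add: image_image)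
  finally have refl: "(\<lambda>b. N - b) ` (B0 - {0}) = {b \<in> B. of_int N * (1 - \<delta>') \<le> of_int b}" .
  show "B = B0 \<union> (\<lambda>b. N - b) ` (B0 - {0})"
    unfolding refl unfolding B0_eq using dich by auto
  show "B0 \<inter> (\<lambda>b. N - b) ` (B0 - {0}) = {}"
    unfolding refl unfolding B0_eq using le less by auto
qed

section \<open>Uniform lower bounds for the tail transforms\<close>

context moran
begin

text \<open>Weak convergence gives only pointwise convergence to
  \<open>\<bar>cos (pi * x)\<bar>\<close>; the common Lipschitz constant makes a finite net
  sufficient for a uniform bound.\<close>

lemma tail_hat_lower_bound:
  assumes weak: "weak_conv_m (moran_tail_rescaled N B) (uniform_delta {0, 1})"
    and \<eta>: "0 < \<eta>" "\<eta> \<le> 1 / 2"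
  shows "\<exists>c>0. \<forall>\<^sub>F n in sequentially. \<forall>x. \<bar>x\<bar> \<le> 1 / 2 - \<eta> \<longrightarrow> c \<le> cmod (tail_hat n x)"
proof -
  have lim: "(\<lambda>n. cmod (tail_hat n x)) \<longlonglongrightarrow> \<bar>cos (pi * x)\<bar>" for x
  proof -
    have "(\<lambda>n. tail_hat n x) \<longlonglongrightarrow> char (uniform_delta {0, 1}) (2 * pi * x)"
      unfolding tail_hat_def
      by (intro levy_continuity1 real_distribution_moran_tail_rescaled
          real_distribution_uniform_delta weak)
    moreover have "cmod (char (uniform_delta {0, 1}) (2 * pi * x)) = \<bar>cos (pi * x)\<bar>"
    proof -
      have "char (uniform_delta {0, 1}) (2 * pi * x) = (1 + iexp (2 * pi * x)) / 2"
        by (subst char_uniform_delta) auto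
      also have "\<dots> = cis (pi * x) * of_real (cos (pi * x))"
        by (simp add: complex_eq_iff Re_exp Im_exp cos_double_cos sin_double power2_eq_square
            mult.assoc[of 2])
      finally show ?thesis by (simp add: norm_mult)
    qed
    ultimately show ?thesis using tendsto_norm by metis
  qed
  \<comment> \<open>A third of the minimum of the limit: the limit is at least \<open>3 * c\<close>,
    late tails exceed \<open>2 * c\<close> on the net, and passing to nearby points costs at most
    \<open>c\<close>.\<close>
  define c where "c = sin (pi * \<eta>) / 3"
  have c: "c > 0" using \<eta> by (auto simp: c_def intro!: sin_gt_zero mult_le_cancel_left_pos[THEN iffD2])
  have cos_ge: "3 * c \<le> \<bar>cos (pi * x)\<bar>" if "\<bar>x\<bar> \<le> 1 / 2 - \<eta>" for x
  proof -
    have "3 * c = cos (pi * (1 / 2 - \<eta>))" by (simp add: c_def right_diff_distrib cos_diff)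
    also have "\<dots> \<le> cos (pi * \<bar>x\<bar>)"
    proof (intro cos_monotone_0_pi_le mult_left_mono)
      have "pi * (1 / 2 - \<eta>) \<le> pi * 1" using \<eta> by (intro mult_left_mono) auto
      then show "pi * (1 / 2 - \<eta>) \<le> pi" by simp
    qed (use that in auto)
    also have "\<dots> \<le> \<bar>cos (pi * x)\<bar>" by (cases "x \<ge> 0") auto
    finally show ?thesis .
  qed
  let ?S = "{x. \<bar>x\<bar> \<le> 1 / 2 - \<eta>}"
  have "?S = {- (1 / 2 - \<eta>)..1 / 2 - \<eta>}" by (auto simp: abs_le_iff)
  then have "seq_compact ?S" by (simp add: compact_imp_seq_compact)
  moreover have "c / (2 * pi) > 0" using c by simp
  ultimately obtain G where G: "finite G" "G \<subseteq> ?S" "?S \<subseteq> (\<Union>x\<in>G. ball x (c / (2 * pi)))"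
    using seq_compact_imp_totally_bounded by metis
  have "\<forall>\<^sub>F n in sequentially. 2 * c < cmod (tail_hat n x)" if "x \<in> G" for x
    by (rule order_tendstoD(1)[OF lim]) (use cos_ge[of x] that G(2) c in auto)
  then have "\<forall>\<^sub>F n in sequentially. \<forall>x\<in>G. 2 * c < cmod (tail_hat n x)"
    using G(1) by (simp add: eventually_ball_finite)
  then have "\<forall>\<^sub>F n in sequentially. \<forall>x. \<bar>x\<bar> \<le> 1 / 2 - \<eta> \<longrightarrow> c \<le> cmod (tail_hat n x)"
  proof eventually_elim
    case (elim n)
    show ?case
    proof (intro allI impI)
      fix x assume "\<bar>x\<bar> \<le> 1 / 2 - \<eta>"
      then obtain y where y: "y \<in> G" "\<bar>y - x\<bar> < c / (2 * pi)"
        using G(3) by (auto simp: dist_real_def subset_iff)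
      have "cmod (tail_hat n y - tail_hat n x) \<le> 2 * pi * \<bar>y - x\<bar>" by (rule tail_hat_lipschitz)
      also have "\<dots> \<le> c" using y(2) by (simp add: field_simps)
      finally show "c \<le> cmod (tail_hat n x)"
        using elim y(1) norm_triangle_ineq2[of "tail_hat n y" "tail_hat n x"] by fastforce
    qed
  qed
  then show ?thesis using c by blast
qed

lemma tail_hat_half_lower_bound:
  assumes weak: "weak_conv_m (moran_tail_rescaled N B) (uniform_delta {0, 1})"
    and card: "filterlim (\<lambda>n. card (B n)) at_top sequentially"
    and symm: "symmetric_sequence N B"
    and \<delta>: "0 < \<delta>" "\<delta> < 1 / 3"
    and r: "strict_mono r"
    and sine: "sum_of_sine {near_zero (N (r j)) (B (r j)) \<delta> | j. j \<ge> 1}"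
  shows "\<exists>\<epsilon>>0. \<forall>\<^sub>F j in sequentially. \<exists>k::int. \<epsilon> \<le> cmod (tail_hat (r j - 1) (1 / 2 + of_int k))"
proof -
  obtain \<epsilon>0 \<delta>0 :: real where \<epsilon>0: "\<epsilon>0 > 0" and \<delta>0_mem: "\<delta>0 \<in> {0<..<1 / 2}"
    and sup_all: "\<forall>A\<in>{near_zero (N (r j)) (B (r j)) \<delta> | j. j \<ge> 1}. \<epsilon>0 * card A \<le>
      (SUP x\<in>{0..1 / 2 - \<delta>0}. \<bar>\<Sum>b\<in>A. sin (2 * pi * of_int b * x)\<bar>)"
    using sine unfolding sum_of_sine_def by blast
  have \<delta>0: "0 < \<delta>0" "\<delta>0 < 1 / 2" using \<delta>0_mem by auto
  have sup: "\<epsilon>0 * card (near_zero (N (r j)) (B (r j)) \<delta>) \<le>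
      (SUP x\<in>{0..1 / 2 - \<delta>0}. \<bar>\<Sum>b\<in>near_zero (N (r j)) (B (r j)) \<delta>. sin (2 * pi * of_int b * x)\<bar>)"
    if "j \<ge> 1" for j
    by (rule bspec[OF sup_all]) (use that in blast)
  \<comment> \<open>The bound \<open>\<epsilon>0 / (4 * pi)\<close> keeps the loss
    \<open>pi * \<delta>'\<close> per digit within \<open>\<epsilon>0 / 4\<close>, half of the sine
    sum secured below.\<close>
  have "0 < min \<delta> (\<epsilon>0 / (4 * pi))" using \<delta> \<epsilon>0 by simp
  then have "\<forall>\<^sub>F \<delta>' in at_right 0. \<delta>' \<in> {0<..<min \<delta> (\<epsilon>0 / (4 * pi))}"
    by (rule eventually_at_right_real)
  from eventually_happens'[OF trivial_limit_at_right_real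
      eventually_conj[OF this symm[unfolded symmetric_sequence_def]]]
  obtain \<delta>' n0 where \<delta>'_mem: "\<delta>' \<in> {0<..<min \<delta> (\<epsilon>0 / (4 * pi))}" and
    n0: "\<And>n. n \<ge> n0 \<Longrightarrow> B n = near_ends (N n) (B n) \<delta>' \<and>
        near_one (N n) (B n) \<delta>' = near_zero (N n) (B n) \<delta>' - {0}"
    by blast
  have \<delta>': "0 < \<delta>'" "\<delta>' < \<delta>" "\<delta>' < \<epsilon>0 / (4 * pi)" using \<delta>'_mem by auto
  \<comment> \<open>Half of the margin \<open>\<delta>0\<close> is reserved for moving from
    \<open>t\<close> to the point \<open>x\<close> where the tail is evaluated.\<close>
  obtain c where c: "c > 0" and
    ev_c: "\<forall>\<^sub>F n in sequentially. \<forall>x. \<bar>x\<bar> \<le> 1 / 2 - \<delta>0 / 2 \<longrightarrow> c \<le> cmod (tail_hat n x)"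
    using tail_hat_lower_bound[OF weak, of "\<delta>0 / 2"] \<delta>0 by auto
  \<comment> \<open>\<open>N n\<close> grows because it is at least \<open>card (B n)\<close>; this
    makes the rounding error \<open>1 / (2 * N n)\<close> at most
    \<open>\<delta>0 / 2\<close>.\<close>
  have ev_N: "\<forall>\<^sub>F n in sequentially. 1 / \<delta>0 \<le> of_int (N n)"
  proof -
    have "\<forall>\<^sub>F n in sequentially. nat \<lceil>1 / \<delta>0\<rceil> \<le> card (B n)"
      using card unfolding filterlim_at_top by blast
    then show ?thesis using eventually_ge_at_top[of 1]
    proof eventually_elim
      case (elim n)
      have "int (card (B n)) \<le> N n" using hadamard[OF elim(2)] by (simp add: hadamard_triple_def)
      then show ?case using elim(1) by linarith
    qed
  qed
  have r_lim: "filterlim r at_top sequentially" by (rule filterlim_subseq[OF r])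
  have "\<forall>\<^sub>F j in sequentially. \<exists>k::int. \<epsilon>0 / 4 * c \<le> cmod (tail_hat (r j - 1) (1 / 2 + of_int k))"
    using eventually_compose_filterlim[OF ev_c r_lim] eventually_compose_filterlim[OF ev_N r_lim]
      eventually_compose_filterlim[OF eventually_ge_at_top[of "max 1 n0"] r_lim] eventually_ge_at_top[of 1]
  proof eventually_elim
    case (elim j)
    define n where "n = r j"
    have n: "n \<ge> 1" "n \<ge> n0" using elim(3) by (auto simp: n_def)
    define B0 where "B0 = near_zero (N n) (B n) \<delta>"
    have N: "N n > 0" and Nr: "0 < real_of_int (N n)" using N_ge[OF n(1)] by auto
    have B0_le: "\<And>b. b \<in> B0 \<Longrightarrow> 0 \<le> b \<and> of_int b \<le> of_int (N n) * \<delta>'"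
      and B_eq: "B n = B0 \<union> (\<lambda>b. N n - b) ` (B0 - {0})"
      and disj: "B0 \<inter> (\<lambda>b. N n - b) ` (B0 - {0}) = {}"
      using near_zero_reflected[OF N digits[OF n(1)], of \<delta>' \<delta>] n0[OF n(2)] \<delta>' \<delta>
      unfolding B0_def by auto
    have finB0: "finite B0" using finite_B[OF n(1)] B_eq by (metis finite_Un)
    have "B0 \<noteq> {}" using B_nonempty[OF n(1)] B_eq by auto
    then have cardB0: "0 < real (card B0)" using finB0 by (simp add: card_gt_0_iff)
    let ?f = "\<lambda>x. \<bar>\<Sum>b\<in>B0. sin (2 * pi * of_int b * x)\<bar>"
    \<comment> \<open>Giving up half of \<open>\<epsilon>0\<close> makes the inequality strict, so
      some point \<open>t\<close> lies above it.\<close>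
    have "\<epsilon>0 / 2 * card B0 < \<epsilon>0 * card B0" using \<epsilon>0 cardB0 by simp
    also have "\<dots> \<le> (SUP x\<in>{0..1 / 2 - \<delta>0}. ?f x)"
      using sup[OF elim(4)] by (simp add: B0_def n_def)
    finally have "\<exists>t\<in>{0..1 / 2 - \<delta>0}. \<epsilon>0 / 2 * card B0 < ?f t"
    proof (subst (asm) less_cSUP_iff)
      have "?f x \<le> card B0" for x
      proof -
        have "?f x \<le> (\<Sum>b\<in>B0. \<bar>sin (2 * pi * of_int b * x)\<bar>)" by (rule sum_abs)
        also have "\<dots> \<le> (\<Sum>b\<in>B0. 1)" by (intro sum_mono) simp
        finally show ?thesis by simp
      qed
      then show "bdd_above (?f ` {0..1 / 2 - \<delta>0})" by (rule bdd_aboveI2)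
    qed (use \<delta>0 in auto)
    then obtain t where t: "0 \<le> t" "t \<le> 1 / 2 - \<delta>0" "\<epsilon>0 / 2 * card B0 < ?f t" by auto
    \<comment> \<open>The half-integer \<open>1 / 2 + k\<close> is the midpoint of the unit interval
      containing \<open>N n * t\<close>.\<close>
    define k where "k = \<lfloor>of_int (N n) * t\<rfloor>"
    have k: "\<bar>1 / 2 + of_int k - of_int (N n) * t\<bar> \<le> 1 / 2"
      unfolding k_def by linarith
    define x where "x = (1 / 2 + real_of_int k) / of_int (N n)"
    \<comment> \<open>The surviving sine sum, at least \<open>\<epsilon>0 / 4\<close> per digit of
      \<open>B0\<close>, counts twice by reflection, while \<open>B n\<close> has at most twice as
      many digits as \<open>B0\<close>.\<close>
    have mask_ge: "\<epsilon>0 / 4 \<le> cmod (digit_mask (B n) x)"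
    proof -
      have "card (B n) \<le> card B0 + card ((\<lambda>b. N n - b) ` (B0 - {0}))"
        by (subst B_eq) (rule card_Un_le)
      also have "\<dots> \<le> card B0 + card B0"
        using finB0 by (intro add_left_mono) (meson card_image_le card_mono Diff_subset finite_Diff order_trans)
      finally have "card (B n) \<le> 2 * card B0" by simp
      then have card_le: "real (card (B n)) \<le> 2 * real (card B0)" by linarith
      have "pi * \<delta>' \<le> \<epsilon>0 / 4" using \<delta>'(3) by (simp add: field_simps)
      then have "pi * \<delta>' * card B0 \<le> \<epsilon>0 / 4 * card B0" by (intro mult_right_mono) auto
      then have "\<epsilon>0 / 2 * card B0 \<le> 2 * (?f t - pi * \<delta>' * card B0)" using t(3) by simp
      also have "\<dots> \<le> card (B n) * cmod (digit_mask (B n) x)"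
        using norm_digit_mask_reflected_ge[OF N finB0 B0_le disj k] by (simp add: B_eq[symmetric] x_def)
      also have "\<dots> \<le> 2 * real (card B0) * cmod (digit_mask (B n) x)"
        by (intro mult_right_mono card_le) auto
      finally show ?thesis using cardB0 by simp
    qed
    have "\<bar>x - t\<bar> \<le> \<delta>0 / 2"
    proof -
      have "x - t = (1 / 2 + of_int k - of_int (N n) * t) / of_int (N n)"
        using Nr by (simp add: x_def field_simps)
      then have "\<bar>x - t\<bar> = \<bar>1 / 2 + of_int k - of_int (N n) * t\<bar> / of_int (N n)"
        using Nr by (simp add: abs_divide)
      also have "\<dots> \<le> (1 / 2) / of_int (N n)" using k Nr by (intro divide_right_mono) auto
      also have "\<dots> \<le> \<delta>0 / 2" using elim(2) Nr \<delta>0 by (simp add: n_def field_simps)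
      finally show ?thesis .
    qed
    then have "\<bar>x\<bar> \<le> 1 / 2 - \<delta>0 / 2" using t(1,2) \<delta>0 by linarith
    then have "c \<le> cmod (tail_hat n x)" using elim(1) by (simp add: n_def)
    then have "\<epsilon>0 / 4 * c \<le> cmod (digit_mask (B n) x) * cmod (tail_hat n x)"
      using mask_ge \<epsilon>0 c by (intro mult_mono) auto
    \<comment> \<open>The digits of \<open>B n\<close> form the first factor of the tail after
      \<open>n - 1\<close>; this explains the index \<open>r j - 1\<close>.\<close>
    also have "\<dots> = cmod (tail_hat (n - 1) (1 / 2 + of_int k))"
      using tail_hat_Suc[of "n - 1" "1 / 2 + of_int k"] n(1) by (simp add: x_def norm_mult)
    finally show ?case by (auto simp: n_def)
  qed
  then show ?thesis using \<epsilon>0 c by (intro exI[of _ "\<epsilon>0 / 4 * c"]) auto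
qed

text \<open>Modulo 1, a point is either \<open>\<eta>\<close>-far from 1/2, where the cosine bound
  applies, or can be translated to within \<open>\<eta>\<close> of the good half-integer
  \<open>1 / 2 + k\<close>, where the Lipschitz bound applies.\<close>

lemma frequently_tail_hat_bound:
  assumes weak: "weak_conv_m (moran_tail_rescaled N B) (uniform_delta {0, 1})"
    and r: "strict_mono r"
    and \<epsilon>: "0 < \<epsilon>"
    and half: "\<forall>\<^sub>F j in sequentially. \<exists>k::int. \<epsilon> \<le> cmod (tail_hat (r j - 1) (1 / 2 + of_int k))"
  shows "\<exists>\<epsilon>'>0. \<exists>\<^sub>F n in sequentially. \<forall>x. \<exists>k::int. \<epsilon>' \<le> cmod (tail_hat n (x + of_int k))"
proof -
  \<comment> \<open>The first bound limits the Lipschitz loss to \<open>\<epsilon> / 2\<close>; the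
    second is required by \<open>tail_hat_lower_bound\<close>.\<close>
  define \<eta> where "\<eta> = min (\<epsilon> / (4 * pi)) (1 / 2)"
  have \<eta>: "0 < \<eta>" "\<eta> \<le> 1 / 2" "2 * pi * \<eta> \<le> \<epsilon> / 2"
  proof -
    have "\<eta> \<le> \<epsilon> / (4 * pi)" by (simp add: \<eta>_def)
    then show "2 * pi * \<eta> \<le> \<epsilon> / 2" by (simp add: field_simps)
  qed (use \<epsilon> in \<open>auto simp: \<eta>_def\<close>)
  obtain c where c: "c > 0" and
    ev_c: "\<forall>\<^sub>F n in sequentially. \<forall>x. \<bar>x\<bar> \<le> 1 / 2 - \<eta> \<longrightarrow> c \<le> cmod (tail_hat n x)"
    using tail_hat_lower_bound[OF weak \<eta>(1,2)] by blast
  define e where "e = min c (\<epsilon> / 2)"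
  have r_lim: "filterlim (\<lambda>j. r j - 1) at_top sequentially"
    using filterlim_compose[OF filterlim_minus_const_nat_at_top[of 1] filterlim_subseq[OF r]] .
  have "\<forall>\<^sub>F j in sequentially. \<forall>x. \<exists>k::int. e \<le> cmod (tail_hat (r j - 1) (x + of_int k))"
    using half eventually_compose_filterlim[OF ev_c r_lim]
  proof eventually_elim
    case (elim j)
    let ?g = "tail_hat (r j - 1)"
    obtain k where k: "\<epsilon> \<le> cmod (?g (1 / 2 + of_int k))" using elim(1) by blast
    have near: "e \<le> cmod (?g y)" if "\<bar>1 / 2 + of_int k - y\<bar> \<le> \<eta>" for y
    proof -
      have "cmod (?g (1 / 2 + of_int k) - ?g y) \<le> 2 * pi * \<bar>1 / 2 + of_int k - y\<bar>"
        by (rule tail_hat_lipschitz)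
      also have "\<dots> \<le> 2 * pi * \<eta>" using that by (intro mult_left_mono) auto
      finally show ?thesis
        using k \<eta>(3) norm_triangle_ineq2[of "?g (1 / 2 + of_int k)" "?g y"] by (simp add: e_def)
    qed
    show ?case
    proof
      fix x :: real
      define y :: real where "y = x - of_int (round x)"
      have y: "\<bar>y\<bar> \<le> 1 / 2" using of_int_round_abs_le[of x] by (simp add: y_def abs_minus_commute)
      consider "\<bar>y\<bar> \<le> 1 / 2 - \<eta>" | "y > 1 / 2 - \<eta>" | "y < - (1 / 2 - \<eta>)" by linarith
      then show "\<exists>k::int. e \<le> cmod (?g (x + of_int k))"
      proof cases
        case 1
        then show ?thesis using elim(2) by (intro exI[of _ "- round x"]) (simp add: y_def e_def min_le_iff_disj)
      next
        case 2
        have "1 / 2 + of_int k - (x + of_int (k - round x)) = 1 / 2 - y" by (simp add: y_def)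
        then have "\<bar>1 / 2 + of_int k - (x + of_int (k - round x))\<bar> \<le> \<eta>" using 2 y by linarith
        then show ?thesis using near by blast
      next
        case 3
        \<comment> \<open>Near -1/2 one further unit of translation brings the point next to
          1/2.\<close>
        have "1 / 2 + of_int k - (x + of_int (k + 1 - round x)) = - 1 / 2 - y" by (simp add: y_def)
        then have "\<bar>1 / 2 + of_int k - (x + of_int (k + 1 - round x))\<bar> \<le> \<eta>" using 3 y by linarith
        then show ?thesis using near by blast
      qed
    qed
  qed
  then have "\<exists>\<^sub>F j in sequentially. \<forall>x. \<exists>k::int. e \<le> cmod (tail_hat (r j - 1) (x + of_int k))"
    by (rule eventually_frequently[OF sequentially_bot])
  \<comment> \<open>The bound holds only along the indices \<open>r j - 1\<close>. As these tend to
    infinity, it holds for infinitely many \<open>n\<close>.\<close>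
  then have "\<exists>\<^sub>F n in filtermap (\<lambda>j. r j - 1) sequentially. \<forall>x. \<exists>k::int. e \<le> cmod (tail_hat n (x + of_int k))"
    by (simp add: frequently_def eventually_filtermap)
  then have "\<exists>\<^sub>F n in sequentially. \<forall>x. \<exists>k::int. e \<le> cmod (tail_hat n (x + of_int k))"
    using r_lim unfolding filterlim_def frequently_def le_filter_def by blast
  then show ?thesis using c \<epsilon> by (intro exI[of _ e]) (simp add: e_def)
qed

end

theorem theorem1p8:
  fixes N :: "nat \<Rightarrow> int" and B L :: "nat \<Rightarrow> int set"
  assumes "\<forall>n\<ge>1. hadamard_triple (N n) (B n) (L n)"
    and "\<forall>n\<ge>1. B n \<subseteq> {0 .. N n - 1}"
    and "weak_conv_m (moran_tail_rescaled N B) (uniform_delta {0, 1})"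
    and "filterlim (\<lambda>n. card (B n)) at_top sequentially"
    and "symmetric_sequence N B"
    and "\<exists>\<delta>::real. 0 < \<delta> \<and> \<delta> < 1/3 \<and>
           (\<exists>r::nat \<Rightarrow> nat. strict_mono r \<and>
              sum_of_sine {near_zero (N (r j)) (B (r j)) \<delta> | j. j \<ge> 1})"
  shows "spectral_measure (cantor_moran N B)"
proof -
  interpret moran N B L
    using assms(1,2) by unfold_locales auto
  obtain \<delta> r where \<delta>: "0 < \<delta>" "\<delta> < 1/3" and r: "strict_mono (r :: nat \<Rightarrow> nat)"
    and sine: "sum_of_sine {near_zero (N (r j)) (B (r j)) \<delta> | j. j \<ge> 1}"
    using assms(6) by blast
  obtain \<epsilon> where \<epsilon>: "0 < \<epsilon>"
    "\<forall>\<^sub>F j in sequentially. \<exists>k::int. \<epsilon> \<le> cmod (tail_hat (r j - 1) (1 / 2 + of_int k))"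
    using tail_hat_half_lower_bound[OF assms(3,4,5) \<delta> r sine] by blast
  show ?thesis
    using frequently_tail_hat_bound[OF assms(3) r \<epsilon>] spectral_measure_cantor_moran by blast
qed

end
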